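(* For $n\ge 1$ let $\mathrm{pk}(n)$ be the number of parking functions of length $n$ whose parking permutations avoid both patterns $1234$ and $2134$, and set $\mathrm{pk}(0)=1$. For $n\ge 1$ and integers $i,r$, let $\mathrm{pk}(n,i)$ be the number of those parking functions whose parking permutation $\pi=\pi_1\cdots\pi_n$ satisfies $\pi_n=i$, and let $\mathrm{pk}(n,i,r)$ be the number of those whose parking permutation $\pi$ satisfies $\pi_n=i$ and $\ell(\pi_n)=r$ (that is, $\pi$ has bi-suffix $(i,r)$). Then for $n\ge 1$ \[\mathrm{pk}(n)=\sum_{i=1}^n \mathrm{pk}(n,i),\qquad \mathrm{pk}(n,i)=\sum_{r=1}^i \mathrm{pk}(n,i,r)\quad(1\le i\le n).\] The values for $n\le 3$ are: $\mathrm{pk}(1,i,r)=1$ if $(i,r)=(1,1)$ and $0$ otherwise; $\mathrm{pk}(2,i,r)=1$ if $(i,r)=(1,1)$, $2$ if $(i,r)=(2,2)$, and $0$ otherwise; $\mathrm{pk}(3,i,r)=3$ if $(i,r)=(1,1)$, $2$ if $(i,r)=(2,1)$ or $(i,r)=(2,2)$, $9$ if $(i,r)=(3,3)$, and $0$ otherwise. For $n\ge 4$ and $1\le r\le i\le n$ (with the first applicable case being used), \[ \mathrm{pk}(n,i,r)= \begin{cases} \displaystyle\sum_{j=i}^{n-1} \mathrm{pk}(n-1,j) & \text{if } r=1,\\[2mm] 2\,\mathrm{pk}(n-2) & \text{if } r=2 \text{ and } i=2,\\[1mm] 4\,\mathrm{pk}(n-1,i-1,1) & \text{if } r=2 \text{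 and } i\neq 2,\\[1mm] \mathrm{pk}(n-r)\,\mathrm{pk}(r,r) & \text{if } i=r \text{ and } i<n, \\[1mm] \displaystyle\frac{n}{n-1}\mathrm{pk}(n-1,n-1,n-1)+\sum_{r_1=2}^{n-1} \frac{2n}{n-r_1}\mathrm{pk}(n-r_1,n-r_1,n-r_1) & \text{if } i=r \text{ and } i=n,\\[2mm] \displaystyle\frac{r}{r-1}\mathrm{pk}(n-1,i-1,r-1) + r\,\mathrm{pk}(n-r+1,i-r+1,1)+ \sum_{r_1=2}^{r-1} \frac{2r}{r-r_1}\mathrm{pk}(n-r_1,i-r_1,r-r_1) & \text{otherwise.} \end{cases} \] The first terms of the sequence $(\mathrm{pk}(n))_{n\ge1}$ are \[1, 3, 16, 89, 534, 3394, 22447, 152901, 1065508, 7560824,\ldots\]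
   Context: Parking functions: there are $n$ spots $1,\dots,n$ on a one-way street and cars $1,\dots,n$ arrive in this order; car $i$ has a preferred spot $a_i\in[n]=\{1,\dots,n\}$. Car $i$ parks in spot $a_i$ if it is free, and otherwise in the first free spot after $a_i$, if one exists. The sequence $\alpha=(a_1,\dots,a_n)$ is a parking function of length $n$ if all cars park. Its parking permutation is $\pi=\pi_1\pi_2\cdots\pi_n\in\mathfrak{S}_n$ (permutations of $[n]$ in one-line notation), where $\pi_i$ is the car that parked in spot $i$. Pattern avoidance: $\pi\in\mathfrak{S}_n$ contains $\sigma\in\mathfrak{S}_m$ if there are $i_1<\cdots<i_m$ such that $\pi_{i_a}<\pi_{i_b}$ if and only if $\sigma_a<\sigma_b$ for all $a,b\in[m]$; otherwise $\pi$ avoids $\sigma$. For $\pi\in\mathfrak{S}_n$ and $i\in[n]$, $\ell(\pi_i)=\max\{k : 1\le k\le i,\ \pi_j\le\pi_i \text{ for all } i-k+1\le j\le i\}$. Empty sums are $0$. *)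

theory Defs
  imports Complex_Main
begin

text \<open>
  Sequences \<open>(a\<^sub>1, \<dots>, a\<^sub>n)\<close> and permutations in one-line notation are lists of natural numbers.
  Mathematical indices start at 1, list positions at 0.
\<close>

definition entry :: "nat list \<Rightarrow> nat \<Rightarrow> nat" where
  "entry xs i = xs ! (i - 1)"

text \<open>
  A street state with spots \<open>1, \<dots>, n\<close> is a partial map from spots to the cars parked there.
  A car that finds no free spot leaves the state unchanged.
\<close>

definition park_car :: "nat \<Rightarrow> nat \<Rightarrow> nat \<Rightarrow> (nat \<rightharpoonup> nat) \<Rightarrow> (nat \<rightharpoonup> nat)" where
  "park_car n c p st =
     (let free = {s \<in> {p..n}. st s = None}
      in if free = {} then st else st(Min free \<mapsto> c))"

primrec street_after :: "nat \<Rightarrow> nat list \<Rightarrow> nat \<Rightarrow> (nat \<rightharpoonup> nat)" where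
  "street_after n as 0 = Map.empty"
| "street_after n as (Suc k) = park_car n (Suc k) (entry as (Suc k)) (street_after n as k)"

definition final_street :: "nat list \<Rightarrow> (nat \<rightharpoonup> nat)" where
  "final_street as = street_after (length as) as (length as)"

definition parking_functions :: "nat \<Rightarrow> nat list set" where
  "parking_functions n =
     {as. length as = n \<and> set as \<subseteq> {1..n} \<and> (\<forall>c\<in>{1..n}. \<exists>s. final_street as s = Some c)}"

definition parking_permutation :: "nat list \<Rightarrow> nat list" where
  "parking_permutation as = map (\<lambda>s. the (final_street as s)) [1..<length as + 1]"

text \<open>The positions \<open>i\<^sub>1 < \<dots> < i\<^sub>m\<close> of an occurrence are \<open>f 0 < \<dots> < f (m - 1)\<close>, counted from 0.\<close>

definition contains_pattern :: "nat list \<Rightarrow> nat list \<Rightarrow> bool" where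
  "contains_pattern \<pi> \<sigma> \<longleftrightarrow>
     (\<exists>f. strict_mono_on {..<length \<sigma>} f \<and> f ` {..<length \<sigma>} \<subseteq> {..<length \<pi>} \<and>
          (\<forall>a<length \<sigma>. \<forall>b<length \<sigma>. \<pi> ! f a < \<pi> ! f b \<longleftrightarrow> \<sigma> ! a < \<sigma> ! b))"

definition avoids :: "nat list \<Rightarrow> nat list \<Rightarrow> bool" where
  "avoids \<pi> \<sigma> \<longleftrightarrow> \<not> contains_pattern \<pi> \<sigma>"

text \<open>\<open>ell \<pi> i\<close> is \<open>\<ell>(\<pi>\<^sub>i)\<close>.\<close>

definition ell :: "nat list \<Rightarrow> nat \<Rightarrow> nat" where
  "ell \<pi> i = Max {k. 1 \<le> k \<and> k \<le> i \<and> (\<forall>j\<in>{i - k + 1..i}. entry \<pi> j \<le> entry \<pi> i)}"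

definition PK :: "nat \<Rightarrow> nat list set" where
  "PK n = {as \<in> parking_functions n.
             avoids (parking_permutation as) [1,2,3,4] \<and>
             avoids (parking_permutation as) [2,1,3,4]}"

text \<open>The counts \<open>pk(n)\<close>, \<open>pk(n,i)\<close> and \<open>pk(n,i,r)\<close>, the latter two for arbitrary integers \<open>i, r\<close>.\<close>

definition pk :: "nat \<Rightarrow> nat" where
  "pk n = (if n = 0 then 1 else card (PK n))"

definition pk2 :: "nat \<Rightarrow> int \<Rightarrow> nat" where
  "pk2 n i = card {as \<in> PK n. int (entry (parking_permutation as) n) = i}"

definition pk3 :: "nat \<Rightarrow> int \<Rightarrow> int \<Rightarrow> nat" where
  "pk3 n i r = card {as \<in> PK n. int (entry (parking_permutation as) n) = i \<and>
                                int (ell (parking_permutation as) n) = r}"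

end

(* Given the parking permutation pi, the car in spot s can have preferred exactly the last ell(pi_s)
   spots up to s, so pi arises from the product of all ell(pi_s) parking functions, and every count
   is a sum of these weights over the permutations avoiding 1234 and 2134.

   In such a permutation each entry below the last entry i has at most one smaller entry before it.
   Hence the entries below i that follow 1 are k, ..., 3, 2 for some k. If 1 belongs to the run of
   entries <= i that ends the permutation, removing 1, k, ..., 3, 2 gives a permutation of the same
   kind with k entries fewer and a run shorter by k; otherwise that run is r, ..., 3, 2, i, and
   removing r, ..., 3, 2 leaves a last run of length 1. A removed block has weight 1, except that k
   has weight 2 when it directly follows 1. If the last run is just i itself, i can be removed, and
   if it consists of all entries <= i, the permutation splits into two independent parts. *)

theory Submission
  imports Defs
begin

section \<open>Parking functions with a given parking permutation\<close>

text \<open>If \<open>i\<close> is the last entry, two smaller entries before some c < i would,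
  together with c and \<open>i\<close>, form 1234 or 2134, whichever way round the two stand. When 1
  stands before c, it already is the one permitted smaller entry, so every other smaller value
  stands after c; this forces the descending order k, ..., 3, 2. The removed block stands directly
  before the last entry. No other remaining entry has it in its past, so their runs and constraints
  do not change. Only the last entry is affected: its run shrinks from r to r - k. Therefore
  \<open>tail_weight\<close> leaves out the weight r of the last entry; it then satisfies a
  recurrence with coefficients 1 and 2, and the fractions of the theorem appear only on returning to
  \<open>pk3\<close>. For the values up to n = 10 the recurrence is solved rather than iterated: if
  r < i, every removal keeps n - r and i - r, so the run length enters only through a Pell factor
  and a table in two indices suffices.\<close>

lemma entry_append: "1 \<le> s \<Longrightarrow> s \<le> length xs \<Longrightarrow> entry (xs @ ys) s = entry xs s"
  by (cases s) (simp_all add: entry_def nth_append)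

lemma entry_mem: "1 \<le> s \<Longrightarrow> s \<le> length xs \<Longrightarrow> entry xs s \<in> set xs"
  by (simp add: entry_def)

lemma map_entry: "map (entry xs) [1..<length xs + 1] = xs"
  by (rule nth_equalityI) (simp_all add: entry_def del: upt_Suc)

lemma bij_betw_entry:
  assumes "distinct xs" "set xs = A"
  shows "bij_betw (entry xs) {1..length xs} A"
proof -
  have "distinct (map (entry xs) [1..<length xs + 1])" unfolding map_entry by (rule assms)
  moreover have "set (map (entry xs) [1..<length xs + 1]) = A" unfolding map_entry by (rule assms)
  moreover have "set [1..<length xs + 1] = {1..length xs}" by auto
  ultimately show ?thesis unfolding bij_betw_def distinct_map set_map by simp
qed

text \<open>A window of entries bounded by entry \<open>s\<close> stays such a window when
  shortened, so the maximal length decides every window \<open>{p..s}\<close>. The additive form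
  \<open>s < p + ell \<pi> s\<close> keeps truncated subtraction out of the later uses.\<close>

lemma ell_bounds:
  assumes "1 \<le> s"
  shows "1 \<le> ell \<pi> s" "ell \<pi> s \<le> s"
    and le_ell_iff: "1 \<le> p \<Longrightarrow> p \<le> s \<Longrightarrow> s < p + ell \<pi> s \<longleftrightarrow> (\<forall>j\<in>{p..s}. entry \<pi> j \<le> entry \<pi> s)"
proof -
  let ?K = "{k. 1 \<le> k \<and> k \<le> s \<and> (\<forall>j\<in>{s - k + 1..s}. entry \<pi> j \<le> entry \<pi> s)}"
  have fin: "finite ?K" by (rule finite_subset[of _ "{..s}"]) auto
  have "1 \<in> ?K" using assms by auto
  then have "?K \<noteq> {}" by blast
  from Max_in[OF fin this] have K: "ell \<pi> s \<in> ?K" unfolding ell_def .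
  then show b: "1 \<le> ell \<pi> s" "ell \<pi> s \<le> s" by auto
  assume p: "1 \<le> p" "p \<le> s"
  show "s < p + ell \<pi> s \<longleftrightarrow> (\<forall>j\<in>{p..s}. entry \<pi> j \<le> entry \<pi> s)"
  proof
    assume "s < p + ell \<pi> s"
    then have "{p..s} \<subseteq> {s - ell \<pi> s + 1..s}" using b by auto
    then show "\<forall>j\<in>{p..s}. entry \<pi> j \<le> entry \<pi> s" using K by blast
  next
    assume "\<forall>j\<in>{p..s}. entry \<pi> j \<le> entry \<pi> s"
    moreover have "s - (s - p + 1) + 1 = p" using p by simp
    ultimately have "s - p + 1 \<in> ?K" using p by simp
    then have "s - p + 1 \<le> ell \<pi> s" unfolding ell_def by (rule Max_ge[OF fin])
    then show "s < p + ell \<pi> s" using p by simp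
  qed
qed

text \<open>That these are exactly the possible preferences of the car that ends in spot
  \<open>s\<close> is the content of \<open>parking_function_prefs\<close> and
  \<open>prefs_parking_function\<close>.\<close>

definition prefs :: "nat list \<Rightarrow> nat \<Rightarrow> nat set" where
  "prefs \<pi> s = {s - ell \<pi> s + 1..s}"

lemma card_prefs: "1 \<le> s \<Longrightarrow> card (prefs \<pi> s) = ell \<pi> s"
  using ell_bounds[where s = s and \<pi> = \<pi>] by (simp add: prefs_def)

lemma in_prefs_iff:
  assumes "1 \<le> s"
  shows "p \<in> prefs \<pi> s \<longleftrightarrow> 1 \<le> p \<and> p \<le> s \<and> (\<forall>j\<in>{p..s}. entry \<pi> j \<le> entry \<pi> s)"
proof (cases "1 \<le> p \<and> p \<le> s")
  case True
  then show ?thesis using le_ell_iff[OF assms, where p = p and \<pi> = \<pi>] by (auto simp: prefs_def)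
qed (auto simp: prefs_def)

text \<open>The street after the first \<open>k\<close> cars, reconstructed from the final outcome:
  cars never move, so a spot is taken by then exactly if its final car is among the first
  \<open>k\<close>.\<close>

definition street_of :: "nat list \<Rightarrow> nat \<Rightarrow> (nat \<rightharpoonup> nat)" where
  "street_of \<pi> k = (\<lambda>s. if s \<in> {1..length \<pi>} \<and> entry \<pi> s \<le> k then Some (entry \<pi> s) else None)"

lemma park_car_eq:
  "{s \<in> {p..n}. st s = None} \<noteq> {} \<Longrightarrow>
    park_car n c p st = st(Min {s \<in> {p..n}. st s = None} \<mapsto> c)"
  by (simp only: park_car_def Let_def if_False)

text \<open>The spots from \<open>p\<close> up to just before \<open>s\<close> finally hold cars
  earlier than \<open>Suc k\<close>, so they are already full and \<open>s\<close> is the first free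
  one.\<close>

lemma park_car_street_of:
  assumes "distinct \<pi>" "s \<in> {1..length \<pi>}" "entry \<pi> s = Suc k" "p \<in> prefs \<pi> s"
  shows "park_car (length \<pi>) (Suc k) p (street_of \<pi> k) = street_of \<pi> (Suc k)"
proof -
  have inj: "inj_on (entry \<pi>) {1..length \<pi>}"
    using bij_betw_entry[OF assms(1) refl] by (rule bij_betw_imp_inj_on)
  have s: "1 \<le> s" "s \<le> length \<pi>" using assms(2) by auto
  have p: "1 \<le> p" "p \<le> s" "\<forall>j\<in>{p..s}. entry \<pi> j \<le> Suc k"
    using assms(3,4) in_prefs_iff[OF s(1)] by auto
  let ?free = "{q \<in> {p..length \<pi>}. street_of \<pi> k q = None}"
  have sf: "s \<in> ?free" using s p assms(3) by (simp add: street_of_def)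
  have "Min ?free = s"
  proof (rule Min_eqI)
    fix q assume q: "q \<in> ?free"
    show "s \<le> q"
    proof (rule ccontr)
      assume "\<not> s \<le> q"
      then have "entry \<pi> q = Suc k"
        using q p s by (auto simp: street_of_def le_Suc_eq split: if_splits)
      then have "q = s" using inj_onD[OF inj] q p assms(2,3) by auto
      then show False using \<open>\<not> s \<le> q\<close> by simp
    qed
  qed (use sf in auto)
  moreover have "park_car (length \<pi>) (Suc k) p (street_of \<pi> k) = (street_of \<pi> k)(Min ?free \<mapsto> Suc k)"
    by (rule park_car_eq) (use sf in blast)
  moreover have "(street_of \<pi> k)(s \<mapsto> Suc k) = street_of \<pi> (Suc k)"
  proof
    fix q
    have "entry \<pi> q \<noteq> Suc k" if "q \<in> {1..length \<pi>}" "q \<noteq> s"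
      using inj_onD[OF inj, of q s] that assms(2,3) by auto
    then show "((street_of \<pi> k)(s \<mapsto> Suc k)) q = street_of \<pi> (Suc k) q"
      using assms(2,3) by (auto simp: street_of_def le_Suc_eq)
  qed
  ultimately show ?thesis by (simp only:)
qed

section \<open>Persistence of parked cars\<close>

lemma street_after_mono:
  assumes "street_after n as k s = Some c"
  shows "street_after n as (Suc k) s = Some c"
proof -
  let ?free = "{q \<in> {entry as (Suc k)..n}. street_after n as k q = None}"
  have "Min ?free \<noteq> s" if "?free \<noteq> {}"
    using Min_in[of ?free] that assms by auto
  then show ?thesis using assms by (auto simp: park_car_def Let_def)
qed

lemma street_after_Suc_SomeD:
  assumes "street_after n as (Suc k) s = Some c"
  shows "street_after n as k s = Some c \<or>
    c = Suc k \<and> street_after n as k s = None \<and> s \<in> {entry as (Suc k)..n} \<and>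
    (\<forall>q\<in>{entry as (Suc k)..<s}. street_after n as k q \<noteq> None)"
proof -
  let ?free = "{q \<in> {entry as (Suc k)..n}. street_after n as k q = None}"
  show ?thesis
  proof (cases "?free \<noteq> {} \<and> s = Min ?free")
    case True
    then have s: "s \<in> ?free" using Min_in[of ?free] by simp
    have "q \<notin> ?free" if "q < s" for q
      using Min_le[of ?free q] that True by auto
    then have "\<forall>q\<in>{entry as (Suc k)..<s}. street_after n as k q \<noteq> None" using s by auto
    moreover have "c = Suc k"
      using assms True park_car_eq[of "entry as (Suc k)" n "street_after n as k" "Suc k"]
      by (simp only: street_after.simps) simp
    ultimately show ?thesis using s by blast
  next
    case False
    then have "street_after n as (Suc k) s = street_after n as k s"
      by (auto simp: park_car_def Let_def)
    then show ?thesis using assms by simp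
  qed
qed

lemma street_after_bounds:
  assumes "street_after n as k s = Some c" "k \<le> length as" "\<forall>a\<in>set as. 1 \<le> a"
  shows "1 \<le> c \<and> c \<le> k \<and> 1 \<le> s \<and> s \<le> n"
  using assms(1,2)
proof (induction k)
  case (Suc k)
  have "1 \<le> entry as (Suc k)" using Suc.prems(2) assms(3) entry_mem[of "Suc k" as] by auto
  then show ?case using street_after_Suc_SomeD[OF Suc.prems(1)] Suc by auto
qed simp

lemma street_after_restrict:
  assumes "k \<le> m"
  shows "street_after n as m s = Some c \<Longrightarrow> c \<le> k \<Longrightarrow> street_after n as k s = Some c"
  using assms
proof (induction m rule: dec_induct)
  case (step m)
  then show ?case using street_after_Suc_SomeD[of n as m s c] by auto
qed

lemma street_after_extend:
  assumes "k \<le> m"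
  shows "street_after n as k s = Some c \<Longrightarrow> street_after n as m s = Some c"
  using assms
  by (induction m rule: dec_induct) (auto intro: street_after_mono simp del: street_after.simps(2))

text \<open>Each of the \<open>n\<close> cars stands on one of \<open>n\<close> spots, so counting
  leaves no spot empty and no car on two spots. As cars never move, the final arrangement determines
  every earlier one.\<close>

lemma parking_function_street:
  assumes "as \<in> parking_functions n"
  defines "\<pi> \<equiv> parking_permutation as"
  shows "distinct \<pi>" "set \<pi> = {1..n}" "length \<pi> = n"
    and "k \<le> n \<Longrightarrow> street_after n as k = street_of \<pi> k"
proof -
  have as: "length as = n" "set as \<subseteq> {1..n}" "\<And>c. c \<in> {1..n} \<Longrightarrow> \<exists>s. final_street as s = Some c"
    using assms by (auto simp: parking_functions_def)
  have pos: "\<forall>a\<in>set as. 1 \<le> a" using as(2) by auto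
  have bnd: "c \<in> {1..k} \<and> s \<in> {1..n}" if "street_after n as k s = Some c" "k \<le> n" for k s c
    using street_after_bounds[OF that(1) _ pos] that(2) as(1) by simp
  have fs: "final_street as = street_after n as n" by (simp add: final_street_def as(1))
  define g where "g s = the (final_street as s)" for s
  let ?D = "dom (final_street as)"
  have D: "?D \<subseteq> {1..n}" using bnd fs by auto
  have gD: "g ` ?D = {1..n}"
  proof (intro equalityI subsetI)
    fix c assume "c \<in> g ` ?D"
    then obtain s where "final_street as s = Some c" by (auto simp: g_def)
    then show "c \<in> {1..n}" using bnd fs by auto
  next
    fix c assume "c \<in> {1..n}"
    then obtain s where "final_street as s = Some c" using as(3) by blast
    then show "c \<in> g ` ?D" by (force simp: g_def)
  qed
  have finD: "finite ?D" using D by (rule finite_subset) simp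
  have "card {1..n} \<le> card ?D" using card_image_le[OF finD, of g] gD by simp
  then have D_eq: "?D = {1..n}" using card_subset_eq[OF _ D] card_mono[OF _ D] by simp
  have inj: "inj_on g {1..n}"
    by (rule eq_card_imp_inj_on) (use gD D_eq in auto)
  have \<pi>: "\<pi> = map g [1..<n + 1]" by (simp add: \<pi>_def parking_permutation_def g_def[abs_def] as(1))
  have set_upt': "set [1..<n + 1] = {1..n}" by auto
  show "distinct \<pi>" unfolding \<pi> distinct_map set_upt' using inj by simp
  show "set \<pi> = {1..n}" unfolding \<pi> set_map set_upt' using gD D_eq by simp
  show len: "length \<pi> = n" by (simp add: \<pi>)
  have ent: "entry \<pi> s = g s" if "s \<in> {1..n}" for s
    using that by (auto simp: entry_def \<pi> simp del: upt_Suc)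
  have fin: "final_street as s = Some (entry \<pi> s)" if "s \<in> {1..n}" for s
  proof -
    have "s \<in> ?D" using that D_eq by simp
    then show ?thesis using ent[OF that] by (auto simp: g_def)
  qed
  assume k: "k \<le> n"
  show "street_after n as k = street_of \<pi> k"
  proof
    fix s
    show "street_after n as k s = street_of \<pi> k s"
    proof (cases "s \<in> {1..n} \<and> entry \<pi> s \<le> k")
      case True
      then have "street_after n as n s = Some (entry \<pi> s)" using fin fs by simp
      from street_after_restrict[OF k this] show ?thesis
        using True len by (simp add: street_of_def)
    next
      case False
      have "street_after n as k s = None"
      proof (rule ccontr)
        assume "street_after n as k s \<noteq> None"
        then obtain c where c: "street_after n as k s = Some c" by blast
        from street_after_extend[OF k c] fin[of s] bnd[OF c k] fs
        have "c = entry \<pi> s" by simp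
        then show False using bnd[OF c k] False by simp
      qed
      then show ?thesis using False len by (auto simp: street_of_def)
    qed
  qed
qed

text \<open>The car drove past all spots between its preference and \<open>s\<close>, so earlier
  cars stood there.\<close>

lemma parking_function_prefs:
  assumes "as \<in> parking_functions n" "s \<in> {1..n}"
  shows "entry as (entry (parking_permutation as) s) \<in> prefs (parking_permutation as) s"
proof -
  let ?\<pi> = "parking_permutation as"
  note \<pi> = parking_function_street[OF assms(1)]
  have "entry ?\<pi> s \<in> {1..n}" using entry_mem[of s ?\<pi>] assms(2) \<pi>(2,3) by simp
  then obtain k where k: "entry ?\<pi> s = Suc k" "Suc k \<le> n" by (cases "entry ?\<pi> s") auto
  have as: "length as = n" "set as \<subseteq> {1..n}" using assms by (auto simp: parking_functions_def)
  have e: "1 \<le> entry as (Suc k)" using entry_mem[of "Suc k" as] k(2) as by auto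
  have S: "street_after n as (Suc k) = street_of ?\<pi> (Suc k)" using \<pi>(4) k(2) by blast
  have K: "street_after n as k = street_of ?\<pi> k" using \<pi>(4) k(2) by simp
  have "street_after n as (Suc k) s = Some (Suc k)" "street_after n as k s = None"
    unfolding S K using assms(2) \<pi>(3) k(1) by (simp_all add: street_of_def)
  then have *: "s \<in> {entry as (Suc k)..n}"
    "\<forall>q\<in>{entry as (Suc k)..<s}. street_after n as k q \<noteq> None"
    using street_after_Suc_SomeD[of n as k s "Suc k"] by auto
  have "entry ?\<pi> q \<le> Suc k" if "q \<in> {entry as (Suc k)..s}" for q
  proof (cases "q = s")
    case False
    then have "street_of ?\<pi> k q \<noteq> None" using * that unfolding K by simp
    then show ?thesis by (simp add: street_of_def split: if_splits)
  qed (simp add: k(1))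
  then show ?thesis
    using assms(2) e *(1) k(1) by (simp add: in_prefs_iff)
qed

text \<open>Conversely, preferences chosen independently from these sets reproduce the arrangement;
  the induction over the cars applies \<open>park_car_street_of\<close> at each step.\<close>

lemma prefs_parking_function:
  assumes "distinct \<pi>" "set \<pi> = {1..n}" "length as = n"
    "\<forall>s\<in>{1..n}. entry as (entry \<pi> s) \<in> prefs \<pi> s"
  shows "as \<in> parking_functions n" "parking_permutation as = \<pi>"
proof -
  have len: "length \<pi> = n" using distinct_card[OF assms(1)] assms(2) by simp
  have bij: "bij_betw (entry \<pi>) {1..n} {1..n}" using bij_betw_entry[OF assms(1,2)] len by simp
  have ex: "\<exists>s\<in>{1..n}. entry \<pi> s = c" if "c \<in> {1..n}" for c
    using that bij by (metis bij_betw_imp_surj_on imageE)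
  have street: "street_after n as k = street_of \<pi> k" if "k \<le> n" for k
    using that
  proof (induction k)
    case 0
    have "entry \<pi> s \<noteq> 0" if "s \<in> {1..n}" for s
      using bij_betw_apply[OF bij that] by simp
    then show ?case by (auto simp: street_of_def len)
  next
    case (Suc k)
    then obtain s where s: "s \<in> {1..n}" "entry \<pi> s = Suc k" using ex[of "Suc k"] by auto
    have "entry as (Suc k) \<in> prefs \<pi> s" using assms(4)[rule_format, OF s(1)] s(2) by simp
    then have "park_car n (Suc k) (entry as (Suc k)) (street_of \<pi> k) = street_of \<pi> (Suc k)"
      using park_car_street_of[OF assms(1), of s k] s len by simp
    then show ?case using Suc by simp
  qed
  have fs: "final_street as = street_of \<pi> n" using street[of n] by (simp add: final_street_def assms(3))
  have Some: "street_of \<pi> n s = Some (entry \<pi> s)" if "s \<in> {1..n}" for s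
    using that bij_betw_apply[OF bij that] by (simp add: street_of_def len)
  have "set as \<subseteq> {1..n}"
  proof
    fix a assume "a \<in> set as"
    then obtain j where j: "j < n" "a = as ! j" using assms(3) by (metis in_set_conv_nth)
    then obtain s where s: "s \<in> {1..n}" "entry \<pi> s = Suc j" using ex[of "Suc j"] by auto
    then have "a \<in> prefs \<pi> s" using assms(4) j by (metis diff_Suc_1 entry_def)
    then show "a \<in> {1..n}" using s(1) by (auto simp: in_prefs_iff)
  qed
  moreover have "\<exists>s. final_street as s = Some c" if "c \<in> {1..n}" for c
    using ex[OF that] Some fs by metis
  ultimately show "as \<in> parking_functions n" using assms(3) by (auto simp: parking_functions_def)
  have "parking_permutation as = map (entry \<pi>) [1..<n + 1]"
    unfolding parking_permutation_def assms(3) fs by (rule map_cong) (use Some in auto)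
  then show "parking_permutation as = \<pi>" using map_entry[of \<pi>] len by simp
qed

lemma card_lists_entry:
  assumes "\<And>c. finite (A c)"
  shows "card {as. length as = n \<and> (\<forall>c\<in>{1..n}. entry as c \<in> A c)} = (\<Prod>c=1..n. card (A c))"
proof (induction n)
  case (Suc n)
  let ?S = "\<lambda>n. {as. length as = n \<and> (\<forall>c\<in>{1..n}. entry as c \<in> A c)}"
  have "bij_betw (\<lambda>(as, a). as @ [a]) (?S n \<times> A (Suc n)) (?S (Suc n))"
  proof (rule bij_betwI')
    fix q assume "q \<in> ?S n \<times> A (Suc n)"
    then show "(\<lambda>(as, a). as @ [a]) q \<in> ?S (Suc n)"
      by (auto simp: entry_def nth_append less_Suc_eq_le le_Suc_eq)
  next
    fix bs assume bs: "bs \<in> ?S (Suc n)"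
    then obtain as a where b: "bs = as @ [a]" by (cases bs rule: rev_cases) auto
    then have "length as = n" "\<forall>c\<in>{1..Suc n}. entry (as @ [a]) c \<in> A c" using bs by auto
    then have "as \<in> ?S n" "a \<in> A (Suc n)"
      by (force simp: entry_append, force simp: entry_def)
    then show "\<exists>q\<in>?S n \<times> A (Suc n). bs = (\<lambda>(as, a). as @ [a]) q" using b
      by (intro bexI[of _ "(as, a)"]) auto
  qed auto
  then have "card (?S (Suc n)) = card (?S n \<times> A (Suc n))" by (rule bij_betw_same_card[symmetric])
  also have "\<dots> = (\<Prod>c=1..Suc n. card (A c))" using Suc by (simp add: card_cartesian_product)
  finally show ?case .
qed simp

lemma card_parking_fibre:
  assumes "distinct \<pi>" "set \<pi> = {1..n}"
  shows "card {as \<in> parking_functions n. parking_permutation as = \<pi>} = (\<Prod>s=1..n. ell \<pi> s)"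
proof -
  have len: "length \<pi> = n" using distinct_card[OF assms(1)] assms(2) by simp
  have bij: "bij_betw (entry \<pi>) {1..n} {1..n}" using bij_betw_entry[OF assms] len by simp
  \<comment> \<open>Preferences are listed by car while \<open>prefs\<close> is indexed by spot, so
    the sets are transported along the inverse of \<open>entry \<pi>\<close>.\<close>
  define B where "B c = prefs \<pi> (inv_into {1..n} (entry \<pi>) c)" for c
  have B: "B (entry \<pi> s) = prefs \<pi> s" if "s \<in> {1..n}" for s
    using that bij_betw_inv_into_left[OF bij that] by (simp add: B_def)
  have "{as \<in> parking_functions n. parking_permutation as = \<pi>} =
      {as. length as = n \<and> (\<forall>c\<in>{1..n}. entry as c \<in> B c)}"
  proof (intro equalityI subsetI)
    fix as assume as: "as \<in> {as \<in> parking_functions n. parking_permutation as = \<pi>}"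
    have "entry as c \<in> B c" if "c \<in> {1..n}" for c
    proof -
      have "c \<in> entry \<pi> ` {1..n}" using that bij_betw_imp_surj_on[OF bij] by simp
      then obtain s where "s \<in> {1..n}" "c = entry \<pi> s" by blast
      then show ?thesis using parking_function_prefs[of as n s] as B by simp
    qed
    then show "as \<in> {as. length as = n \<and> (\<forall>c\<in>{1..n}. entry as c \<in> B c)}"
      using as by (simp add: parking_functions_def)
  next
    fix as assume as: "as \<in> {as. length as = n \<and> (\<forall>c\<in>{1..n}. entry as c \<in> B c)}"
    have "entry as (entry \<pi> s) \<in> prefs \<pi> s" if "s \<in> {1..n}" for s
      using as B[OF that] bij_betw_apply[OF bij that] by auto
    then show "as \<in> {as \<in> parking_functions n. parking_permutation as = \<pi>}"
      using prefs_parking_function[OF assms] as by auto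
  qed
  moreover have "finite (B c)" for c by (simp add: B_def prefs_def)
  ultimately have "card {as \<in> parking_functions n. parking_permutation as = \<pi>} = (\<Prod>c=1..n. card (B c))"
    using card_lists_entry[of B n] by simp
  also have "\<dots> = (\<Prod>s=1..n. card (B (entry \<pi> s)))"
    by (rule prod.reindex_bij_betw[OF bij, symmetric])
  also have "\<dots> = (\<Prod>s=1..n. ell \<pi> s)"
    by (rule prod.cong) (auto simp: B card_prefs)
  finally show ?thesis .
qed

section \<open>Weights of reversed permutations\<close>

text \<open>From here on permutations are read from right to left, so that the last entry of the one-line
  notation is the head of the list and recursion over lists removes last entries.\<close>

primrec thin_below :: "nat \<Rightarrow> nat list \<Rightarrow> bool" where
  "thin_below v [] \<longleftrightarrow> True"
| "thin_below v (x # xs) \<longleftrightarrow> thin_below v xs \<and> (x < v \<longrightarrow> length (filter (\<lambda>y. y < x) xs) \<le> 1)"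

text \<open>In the permutation: an entry with a larger one after it has at most one smaller entry
  before it. This is avoidance of both patterns, see \<open>avoids_iff_good\<close>.\<close>

primrec good :: "nat list \<Rightarrow> bool" where
  "good [] \<longleftrightarrow> True"
| "good (x # xs) \<longleftrightarrow> good xs \<and> thin_below x xs"

text \<open>This is \<open>ell\<close> of a last entry \<open>x\<close> that is preceded by
  \<open>ys\<close>, read backwards; the \<open>Suc\<close> counts \<open>x\<close> itself.\<close>

definition run :: "nat \<Rightarrow> nat list \<Rightarrow> nat" where
  "run x ys = Suc (length (takeWhile (\<lambda>y. y < x) ys))"

primrec weight :: "nat list \<Rightarrow> nat" where
  "weight [] = 1"
| "weight (x # xs) = run x xs * weight xs"

definition arrangements :: "'a set \<Rightarrow> 'a list set" where
  "arrangements A = {xs. distinct xs \<and> set xs = A}"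

definition good_perms :: "nat \<Rightarrow> nat list set" where
  "good_perms n = {xs \<in> arrangements {1..n}. good xs}"

definition tails :: "nat \<Rightarrow> nat \<Rightarrow> nat \<Rightarrow> nat list set" where
  "tails n i r = {ys. i # ys \<in> good_perms n \<and> run i ys = r}"

definition tail_weight :: "nat \<Rightarrow> nat \<Rightarrow> nat \<Rightarrow> nat" where
  "tail_weight n i r = (\<Sum>ys\<in>tails n i r. weight ys)"

definition good_weight :: "nat \<Rightarrow> nat" where
  "good_weight n = (\<Sum>xs\<in>good_perms n. weight xs)"

definition good_weight_last :: "nat \<Rightarrow> nat \<Rightarrow> nat" where
  "good_weight_last n i = (\<Sum>xs | xs \<in> good_perms n \<and> hd xs = i. weight xs)"

section \<open>Finiteness and relabelling of arrangements\<close>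

lemma finite_arrangements: "finite A \<Longrightarrow> finite (arrangements A)"
  unfolding arrangements_def
  by (rule finite_subset[OF _ finite_subset_distinct[of A]]) auto

lemma finite_good_perms [simp]: "finite (good_perms n)"
  unfolding good_perms_def using finite_arrangements[of "{1..n}"] by simp

lemma finite_tails [simp]: "finite (tails n i r)"
proof -
  have "tails n i r \<subseteq> tl ` good_perms n"
    unfolding tails_def by force
  then show ?thesis by (rule finite_subset) simp
qed

lemma bij_betw_map_arrangements:
  assumes "inj_on f A"
  shows "bij_betw (map f) (arrangements A) (arrangements (f ` A))"
proof (rule bij_betw_byWitness[where f' = "map (inv_into A f)"])
  show "\<forall>xs\<in>arrangements A. map (inv_into A f) (map f xs) = xs"
    using assms by (auto simp: arrangements_def intro!: map_idI)
  show "\<forall>xs\<in>arrangements (f ` A). map f (map (inv_into A f) xs) = xs"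
    by (auto simp: arrangements_def f_inv_into_f intro!: map_idI)
  show "map f ` arrangements A \<subseteq> arrangements (f ` A)"
    using assms by (auto simp: arrangements_def distinct_map)
  show "map (inv_into A f) ` arrangements (f ` A) \<subseteq> arrangements A"
    using assms by (auto simp: arrangements_def distinct_map inj_on_inv_into)
qed

lemma arrangements_image:
  "inj_on f A \<Longrightarrow> arrangements (f ` A) = map f ` arrangements A"
  by (rule bij_betw_imp_surj_on[OF bij_betw_map_arrangements, symmetric])

lemma thin_below_mono: "thin_below v xs \<Longrightarrow> u \<le> v \<Longrightarrow> thin_below u xs"
  by (induction xs) auto

lemma thin_below_appendD: "thin_below v (xs @ ys) \<Longrightarrow> thin_below v ys"
  by (induction xs) auto

lemma good_appendD: "good (xs @ ys) \<Longrightarrow> good ys"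
  by (induction xs) auto

text \<open>Thinness below \<open>v\<close> of the whole list passes to its suffixes and to every
  smaller bound, which is all that goodness asks of the entries \<open>x \<le> v\<close> of the
  prefix.\<close>

lemma good_appendI:
  "good ys \<Longrightarrow> thin_below v (xs @ ys) \<Longrightarrow> \<forall>x\<in>set xs. x \<le> v \<Longrightarrow> good (xs @ ys)"
  by (induction xs) (auto intro: thin_below_mono)

section \<open>Invariance under order-preserving relabelling\<close>

lemma strict_mono_on_filter_less:
  fixes f :: "nat \<Rightarrow> nat"
  assumes "strict_mono_on A f" "x \<in> A" "set xs \<subseteq> A"
  shows "filter (\<lambda>y. y < f x) (map f xs) = map f (filter (\<lambda>y. y < x) xs)"
  using assms(3) strict_mono_on_less[OF assms(1) _ assms(2)] by (induction xs) auto

lemma thin_below_map: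
  assumes "strict_mono_on A f" "v \<in> A" "set xs \<subseteq> A"
  shows "thin_below (f v) (map f xs) \<longleftrightarrow> thin_below v xs"
  using assms(3)
proof (induction xs)
  case (Cons x xs)
  then have "filter (\<lambda>y. y < f x) (map f xs) = map f (filter (\<lambda>y. y < x) xs)"
    by (intro strict_mono_on_filter_less[OF assms(1)]) auto
  then show ?case
    using Cons strict_mono_on_less[OF assms(1) _ assms(2), of x] by (simp del: filter_map)
qed simp

lemma good_map:
  assumes "strict_mono_on A f" "set xs \<subseteq> A"
  shows "good (map f xs) \<longleftrightarrow> good xs"
  using assms(2)
proof (induction xs)
  case (Cons x xs)
  then show ?case using thin_below_map[OF assms(1), of x xs] by simp
qed simp

lemma run_map:
  assumes "strict_mono_on A f" "v \<in> A" "set xs \<subseteq> A"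
  shows "run (f v) (map f xs) = run v xs"
  using assms(3) strict_mono_on_less[OF assms(1) _ assms(2)]
  by (induction xs) (auto simp: run_def)

lemma weight_map:
  assumes "strict_mono_on A f" "set xs \<subseteq> A"
  shows "weight (map f xs) = weight xs"
  using assms(2)
proof (induction xs)
  case (Cons x xs)
  then show ?case using run_map[OF assms(1), of x xs] by simp
qed simp

section \<open>Concatenation of low entries with high ones\<close>

lemma run_append_low:
  assumes "\<forall>y\<in>set ys. x < y"
  shows "run x (xs @ ys) = run x xs"
proof -
  have "takeWhile (\<lambda>y. y < x) ys = []"
    using assms by (cases ys) auto
  then show ?thesis
    by (cases "\<forall>y\<in>set xs. y < x")
      (simp_all add: run_def takeWhile_append takeWhile_eq_all_conv[THEN iffD2])
qed

lemma weight_append_low: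
  "\<forall>x\<in>set xs. \<forall>y\<in>set ys. x < y \<Longrightarrow> weight (xs @ ys) = weight xs * weight ys"
  by (induction xs) (auto simp: run_append_low)

lemma thin_below_append_low:
  assumes "\<forall>x\<in>set xs. \<forall>y\<in>set ys. x < y" "\<forall>y\<in>set ys. v \<le> y"
  shows "thin_below v (xs @ ys) \<longleftrightarrow> thin_below v xs"
  using assms(1)
proof (induction xs)
  case Nil
  show ?case using assms(2) by (induction ys) auto
next
  case (Cons x xs)
  then have "filter (\<lambda>y. y < x) ys = []" by (auto simp: filter_empty_conv)
  then show ?case using Cons by simp
qed

text \<open>In the permutation \<open>ys\<close> stands before \<open>xs\<close>. An entry of
  \<open>xs\<close> has nothing smaller in \<open>ys\<close>, and an entry of \<open>ys\<close> has
  nothing larger after it in \<open>xs\<close>, so neither part constrains the other.\<close>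

lemma good_append_low:
  assumes "\<forall>x\<in>set xs. \<forall>y\<in>set ys. x < y"
  shows "good (xs @ ys) \<longleftrightarrow> good xs \<and> good ys"
  using assms
proof (induction xs)
  case (Cons x xs)
  then show ?case using thin_below_append_low[of xs ys x] by (auto simp: less_imp_le)
qed simp

section \<open>Permutations with prescribed last entry and last run\<close>

lemma tailsD:
  assumes "ys \<in> tails n i r"
  shows "distinct ys" "set ys = {1..n} - {i}" "i \<in> {1..n}" "good ys" "thin_below i ys"
    "run i ys = r" "length ys = n - 1"
proof -
  have a: "distinct (i # ys)" "set (i # ys) = {1..n}" "good (i # ys)" "run i ys = r"
    using assms by (simp_all add: tails_def good_perms_def arrangements_def)
  show *: "distinct ys" "set ys = {1..n} - {i}" "i \<in> {1..n}" "good ys" "thin_below i ys" "run i ys = r"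
    unfolding a(2)[symmetric] using a(1,3,4) by auto
  show "length ys = n - 1" using distinct_card[OF *(1)] *(2,3) by simp
qed

lemma tailsI:
  assumes "distinct ys" "set ys = {1..n} - {i}" "i \<in> {1..n}" "good ys" "thin_below i ys"
    "run i ys = r"
  shows "ys \<in> tails n i r"
proof -
  have "set (i # ys) = {1..n}" using assms(3) unfolding list.set assms(2) by auto
  then show ?thesis
    using assms by (simp add: tails_def good_perms_def arrangements_def)
qed

lemma tails_elems:
  assumes "ys \<in> tails n i r" "y \<in> set ys"
  shows "1 \<le> y" "y \<le> n" "y \<noteq> i"
  using assms(2) unfolding tailsD(2)[OF assms(1)] by auto

lemma run_less_all:
  assumes "\<forall>y\<in>set ys. y < x"
  shows "run x ys = Suc (length ys)"
proof -
  have "takeWhile (\<lambda>y. y < x) ys = ys" using assms by (simp add: takeWhile_eq_all_conv)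
  then show ?thesis unfolding run_def by presburger
qed

lemma take_run:
  assumes "ys \<in> tails n i r"
  obtains xs zs where "ys = xs @ zs" "Suc (length xs) = r" "\<forall>x\<in>set xs. x < i"
    "zs \<noteq> [] \<longrightarrow> i < hd zs"
proof
  let ?P = "\<lambda>y. y < i"
  show "ys = takeWhile ?P ys @ dropWhile ?P ys" by simp
  show "Suc (length (takeWhile ?P ys)) = r"
    using tailsD(6)[OF assms] by (simp add: run_def)
  show "\<forall>x\<in>set (takeWhile ?P ys). x < i" using set_takeWhileD by fastforce
  show "dropWhile ?P ys \<noteq> [] \<longrightarrow> i < hd (dropWhile ?P ys)"
  proof
    assume ne: "dropWhile ?P ys \<noteq> []"
    have "hd (dropWhile ?P ys) \<in> set ys"
      using ne by (metis hd_in_set set_dropWhileD)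
    then have "hd (dropWhile ?P ys) \<noteq> i" using tailsD(2)[OF assms] by auto
    then show "i < hd (dropWhile ?P ys)" using hd_dropWhile[OF ne] by simp
  qed
qed

lemma tails_empty:
  assumes "\<not> (1 \<le> r \<and> r \<le> i \<and> i \<le> n)"
  shows "tails n i r = {}"
proof (rule equals0I)
  fix ys assume ys: "ys \<in> tails n i r"
  then obtain xs zs where xs: "ys = xs @ zs" "Suc (length xs) = r" "\<forall>x\<in>set xs. x < i"
    by (rule take_run)
  have "set xs \<subseteq> {1..<i}" using xs(1,3) tails_elems[OF ys] by auto
  then have "card (set xs) \<le> i - 1" using card_mono[of "{1..<i}"] by simp
  then have "r \<le> i"
    using tailsD(1,3)[OF ys] xs distinct_card[of xs] by auto
  then show False using assms tailsD(3)[OF ys] xs(2) by auto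
qed

lemma strict_mono_on_add: "strict_mono_on A (\<lambda>x::nat. x + k)"
  by (auto simp: strict_mono_on_def)

text \<open>The \<open>r\<close> entries of the last run are at most \<open>r\<close>, hence they
  are exactly 1 to \<open>r\<close>; the others, lowered by \<open>r\<close>, form an arbitrary good
  permutation.\<close>

lemma tail_weight_diagonal:
  assumes "1 \<le> r" "r \<le> n"
  shows "tail_weight n r r = good_weight (n - r) * tail_weight r r r"
proof -
  let ?f = "\<lambda>(xs, ys). xs @ map (\<lambda>x. x + r) ys"
  have img: "(\<lambda>x::nat. x + r) ` {1..n - r} = {r + 1..n}"
    using assms by (simp add: image_add_atLeastAtMost')
  have low: "\<forall>x\<in>set xs. \<forall>y\<in>set (map (\<lambda>x. x + r) ys). x < y"
    if "xs \<in> tails r r r" "ys \<in> good_perms (n - r)" for xs ys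
    using that(2) tailsD(2)[OF that(1)] by (auto simp: good_perms_def arrangements_def)
  have "bij_betw ?f (tails r r r \<times> good_perms (n - r)) (tails n r r)"
  proof (rule bij_betwI')
    fix p q assume "p \<in> tails r r r \<times> good_perms (n - r)" "q \<in> tails r r r \<times> good_perms (n - r)"
    then show "(?f p = ?f q) = (p = q)"
      by (auto simp: tailsD(7) inj_map_eq_map inj_def)
  next
    fix p assume "p \<in> tails r r r \<times> good_perms (n - r)"
    then obtain xs ys where p: "p = (xs, ys)" "xs \<in> tails r r r" "ys \<in> good_perms (n - r)"
      by auto
    note xs = tailsD[OF p(2)]
    have ys: "distinct ys" "set ys = {1..n - r}" "good ys"
      using p(3) by (auto simp: good_perms_def arrangements_def)
    have sm: "set (map (\<lambda>x. x + r) ys) = {r + 1..n}"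
      using img ys(2) by simp
    have "xs @ map (\<lambda>x. x + r) ys \<in> tails n r r"
    proof (rule tailsI)
      show "distinct (xs @ map (\<lambda>x. x + r) ys)"
        using xs ys(1) sm by (auto simp: distinct_map)
      show "set (xs @ map (\<lambda>x. x + r) ys) = {1..n} - {r}"
        using xs(2) sm assms by auto
      show "r \<in> {1..n}" using assms by simp
      show "good (xs @ map (\<lambda>x. x + r) ys)"
        using good_append_low[OF low[OF p(2,3)]] xs(4) ys(3)
          good_map[OF strict_mono_on_add[of UNIV]] by simp
      show "thin_below r (xs @ map (\<lambda>x. x + r) ys)"
        using thin_below_append_low[OF low[OF p(2,3)]] xs(5) by auto
      show "run r (xs @ map (\<lambda>x. x + r) ys) = r"
        using run_append_low[of "map (\<lambda>x. x + r) ys" r xs] xs(6) ys(2) by auto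
    qed
    then show "?f p \<in> tails n r r" using p(1) by simp
  next
    fix us assume us: "us \<in> tails n r r"
    then obtain xs zs where xs: "us = xs @ zs" "Suc (length xs) = r" "\<forall>x\<in>set xs. x < r"
      by (rule take_run)
    note u = tailsD[OF us]
    have "set xs \<subseteq> {1..<r}" using xs(1,3) tails_elems[OF us] by auto
    moreover have "card (set xs) = card {1..<r}"
      using u(1) xs(1,2) distinct_card[of xs] by simp
    ultimately have sx: "set xs = {1..<r}" by (simp add: card_subset_eq)
    have sz: "set zs = {r + 1..n}"
    proof -
      have "set zs = set us - set xs" using u(1) xs(1) by auto
      also have "\<dots> = ({1..n} - {r}) - {1..<r}" by (simp only: u(2) sx)
      also have "\<dots> = {r + 1..n}" by auto
      finally show ?thesis .
    qed
    have "zs \<in> arrangements ((\<lambda>x. x + r) ` {1..n - r})"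
      unfolding img arrangements_def using sz u(1) xs(1) by simp
    also have "\<dots> = map (\<lambda>x. x + r) ` arrangements {1..n - r}"
      by (rule arrangements_image) simp
    finally obtain ys where ys: "zs = map (\<lambda>x. x + r) ys" "ys \<in> arrangements {1..n - r}"
      by (rule imageE)
    have low': "\<forall>x\<in>set xs. \<forall>y\<in>set zs. x < y" using sx sz by auto
    have g: "good xs \<and> good zs" using good_append_low[OF low'] u(4) xs(1) by simp
    have "ys \<in> good_perms (n - r)"
      using ys g good_map[OF strict_mono_on_add[of UNIV]] by (simp add: good_perms_def)
    moreover have "xs \<in> tails r r r"
    proof (rule tailsI)
      show "thin_below r xs" using thin_below_append_low[OF low'] u(5) xs(1) sz by auto
      show "run r xs = r" using run_less_all[OF xs(3)] xs(2) by simp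
    qed (use sx g u(1) xs(1) assms in auto)
    ultimately show "\<exists>p\<in>tails r r r \<times> good_perms (n - r). us = ?f p"
      using xs(1) ys(1) by (intro bexI[of _ "(xs, ys)"]) auto
  qed
  then have "tail_weight n r r = (\<Sum>p\<in>tails r r r \<times> good_perms (n - r). weight (?f p))"
    unfolding tail_weight_def by (rule sum.reindex_bij_betw[symmetric])
  also have "\<dots> = (\<Sum>p\<in>tails r r r \<times> good_perms (n - r). weight (fst p) * weight (snd p))"
  proof (rule sum.cong[OF refl], clarify)
    fix xs ys assume p: "xs \<in> tails r r r" "ys \<in> good_perms (n - r)"
    then show "weight (xs @ map (\<lambda>x. x + r) ys) = weight (fst (xs, ys)) * weight (snd (xs, ys))"
      using weight_append_low[OF low[OF p]] weight_map[OF strict_mono_on_add[of UNIV]] by simp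
  qed
  also have "\<dots> = tail_weight r r r * good_weight (n - r)"
    by (simp add: tail_weight_def good_weight_def sum_product sum.cartesian_product split_def)
  finally show ?thesis by simp
qed

text \<open>Since 1 lies in \<open>ys\<close>, it is the one smaller entry that any \<open>x\<close>
  in \<open>xs\<close> may have behind it in the list. So \<open>x\<close> must be the least
  remaining value \<open>a\<close>, which otherwise would be a second one. The lower end
  \<open>a\<close> is general so that the induction can pass to \<open>Suc a\<close>.\<close>

lemma thin_below_prefix:
  assumes "thin_below v (xs @ ys)" "distinct (xs @ ys)" "set (xs @ ys) = insert 1 {a..n} - {v}"
    "1 < a" "1 \<in> set ys" "\<forall>x\<in>set xs. x < v"
  shows "xs = [a..<a + length xs]"
  using assms
proof (induction xs arbitrary: a)
  case (Cons x xs)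
  have "x \<in> insert 1 {a..n} - {v}" unfolding Cons.prems(3)[symmetric] by simp
  moreover have "x \<noteq> 1" using Cons.prems(2,5) by auto
  ultimately have x1: "1 < x" "x \<in> {a..n}" using Cons.prems(4) by auto
  then have xa: "a \<le> x" "x \<le> n" by auto
  have len: "length (filter (\<lambda>y. y < x) (xs @ ys)) \<le> 1"
    using Cons.prems(1,6) by simp
  have "x = a"
  proof (rule ccontr)
    assume "x \<noteq> a"
    then have ax: "a < x" using xa by simp
    have "a \<in> set ((x # xs) @ ys)" unfolding Cons.prems(3) using xa ax Cons.prems(6) by simp
    then have a: "a \<in> set (xs @ ys)" using ax by simp
    have sub: "{1, a} \<subseteq> set (filter (\<lambda>y. y < x) (xs @ ys))"
      using a ax x1 Cons.prems(5) by auto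
    have "card {1, a} \<le> card (set (filter (\<lambda>y. y < x) (xs @ ys)))"
      using sub by (rule card_mono[rotated]) simp
    also have "\<dots> = length (filter (\<lambda>y. y < x) (xs @ ys))"
      using Cons.prems(2) by (intro distinct_card) auto
    finally show False using len Cons.prems(4) by simp
  qed
  moreover have "xs = [Suc a..<Suc a + length xs]"
  proof (rule Cons.IH)
    have "set (xs @ ys) = set ((x # xs) @ ys) - {x}" using Cons.prems(2) by auto
    also have "\<dots> = insert 1 {Suc a..n} - {v}"
      unfolding Cons.prems(3) using Cons.prems(4) \<open>x = a\<close> by auto
    finally show "set (xs @ ys) = insert 1 {Suc a..n} - {v}" .
  qed (use Cons.prems(1,2,4-6) in auto)
  ultimately show ?case by (simp add: upt_rec)
qed simp

text \<open>In an ascending block nothing smaller follows a value within the block, so only the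
  entries of \<open>ys\<close> below \<open>b\<close> count.\<close>

lemma thin_below_upt_append:
  assumes "thin_below v ys" "length (filter (\<lambda>y. y < b) ys) \<le> 1"
  shows "thin_below v ([a..<b] @ ys)"
proof (induction "b - a" arbitrary: a)
  case 0
  then show ?case using assms by simp
next
  case (Suc k)
  then have ab: "a < b" by simp
  have "filter (\<lambda>y. y < a) [Suc a..<b] = []" by (auto simp: filter_empty_conv)
  moreover have "length (filter (\<lambda>y. y < a) ys) \<le> length (filter (\<lambda>y. y < b) ys)"
    using ab by (induction ys) auto
  moreover have "thin_below v ([Suc a..<b] @ ys)" using Suc by simp
  ultimately show ?case using ab assms(2) by (simp add: upt_conv_Cons)
qed

text \<open>Every value of the block has run length 1, being followed at once by an entry that is
  not smaller: the next value of the block or, for \<open>b - 1\<close>, the head of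
  \<open>ys\<close>.\<close>

lemma weight_upt_append:
  assumes "ys \<noteq> [] \<longrightarrow> b \<le> Suc (hd ys)"
  shows "weight ([a..<b] @ ys) = weight ys"
proof (induction "b - a" arbitrary: a)
  case (Suc k)
  then have ab: "a < b" by simp
  have "takeWhile (\<lambda>y. y < a) ([Suc a..<b] @ ys) = []"
  proof (cases "Suc a < b")
    case False
    then show ?thesis using ab assms by (cases ys) auto
  qed (simp add: upt_conv_Cons)
  then show ?case using Suc ab by (simp add: upt_conv_Cons run_def)
qed simp

section \<open>Removing a block in front of the last entry\<close>

text \<open>Read from left to right these are the blocks \<open>1, k, \<dots>, 3, 2\<close> and \<open>k + 1, \<dots>, 3, 2\<close>, placed
  directly before the last entry; the old entries are shifted upwards to make room, except that an
  entry \<open>1\<close> keeps its value in the second case.\<close>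

definition low_block :: "nat \<Rightarrow> nat list \<Rightarrow> nat list" where
  "low_block k ys = [2..<Suc k] @ 1 # map (\<lambda>x. x + k) ys"

text \<open>Fixing 0 along with 1 makes the map strictly increasing on all natural numbers.\<close>

definition bump :: "nat \<Rightarrow> nat \<Rightarrow> nat" where
  "bump k x = (if x \<le> 1 then x else x + k)"

definition above_one_block :: "nat \<Rightarrow> nat list \<Rightarrow> nat list" where
  "above_one_block k ys = [2..<k + 2] @ map (bump k) ys"

lemma strict_mono_on_bump: "strict_mono_on A (bump k)"
  by (auto simp: strict_mono_on_def bump_def)

lemma inj_bump: "inj (bump k)"
  by (auto simp: inj_def bump_def split: if_splits)

lemma image_add_tails:
  assumes "k < i" "i \<le> n"
  shows "(\<lambda>x::nat. x + k) ` ({1..n - k} - {i - k}) = {k + 1..n} - {i}"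
proof -
  have "(\<lambda>x::nat. x + k) ` ({1..n - k} - {i - k}) = (\<lambda>x. x + k) ` {1..n - k} - (\<lambda>x. x + k) ` {i - k}"
    by (rule image_set_diff) simp
  then show ?thesis using assms by (simp add: image_add_atLeastAtMost')
qed

lemma image_bump_tails:
  assumes "k + 1 < i" "i \<le> n"
  shows "bump k ` ({1..n - k} - {i - k}) = insert 1 {k + 2..n} - {i}"
proof -
  have "{1..n - k} - {i - k} = insert 1 ({2..n - k} - {i - k})" using assms by auto
  also have "bump k ` \<dots> = insert (bump k 1) (bump k ` ({2..n - k} - {i - k}))"
    by (rule image_insert)
  also have "bump k ` ({2..n - k} - {i - k}) = (\<lambda>x. x + k) ` ({2..n - k} - {i - k})"
    by (rule image_cong) (auto simp: bump_def)
  also have "bump k 1 = 1"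
    by (simp add: bump_def)
  also have "(\<lambda>x. x + k) ` ({2..n - k} - {i - k}) = (\<lambda>x. x + k) ` {2..n - k} - (\<lambda>x. x + k) ` {i - k}"
    by (rule image_set_diff) simp
  also have "insert 1 \<dots> = insert 1 {k + 2..n} - {i}"
    using assms by (auto simp: image_add_atLeastAtMost')
  finally show ?thesis .
qed

lemma run_append_all:
  assumes "\<forall>x\<in>set xs. x < i"
  shows "run i (xs @ ys) = length xs + run i ys"
  using assms by (induction xs) (auto simp: run_def)

lemma weight_low_block:
  assumes "1 \<le> k" "\<forall>y\<in>set ys. 1 \<le> y"
  shows "weight (low_block k ys) = (if k = 1 then 1 else 2) * weight ys"
proof -
  have run1: "run x (map (\<lambda>x. x + k) ys) = 1" if "x \<le> k" for x
    using that assms(2) by (cases ys) (auto simp: run_def)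
  have w: "weight (map (\<lambda>x. x + k) ys) = weight ys"
    by (rule weight_map[OF strict_mono_on_add[of UNIV]]) simp
  show ?thesis
  proof (cases "k = 1")
    case True
    then show ?thesis using run1[of 1] w by (simp add: low_block_def)
  next
    case False
    \<comment> \<open>The value \<open>k\<close> is split off because it alone has run length 2: its
      run takes in the 1 and stops at the shifted entries, which exceed \<open>k\<close>.\<close>
    then have "low_block k ys = [2..<k] @ k # 1 # map (\<lambda>x. x + k) ys"
      using assms(1) by (simp add: low_block_def)
    then have "weight (low_block k ys) = weight (k # 1 # map (\<lambda>x. x + k) ys)"
      by (simp add: weight_upt_append)
    also have "run k (1 # map (\<lambda>x. x + k) ys) = 2"
      using False assms(1) run1[of k] by (simp add: run_def)
    then have "weight (k # 1 # map (\<lambda>x. x + k) ys) = 2 * weight ys"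
      using run1[of 1] assms(1) w by simp
    finally show ?thesis using False by simp
  qed
qed

text \<open>The shifted entries all exceed \<open>k\<close>, so behind the values 2 to
  \<open>k\<close> the entry 1 is the only smaller one, as thinness permits. All \<open>k\<close>
  new entries are below \<open>i\<close> and prolong its run.\<close>

lemma low_block_in_tails:
  assumes "1 \<le> k" "k < r" "r \<le> i" "i \<le> n" "ys \<in> tails (n - k) (i - k) (r - k)"
  shows "low_block k ys \<in> tails n i r"
proof -
  let ?zs = "map (\<lambda>x. x + k) ys"
  note ys = tailsD[OF assms(5)]
  have ki: "k < i" using assms by simp
  have zs: "set ?zs = {k + 1..n} - {i}" "distinct ?zs" "good ?zs"
    using image_add_tails[OF ki assms(4)] ys good_map[OF strict_mono_on_add[of UNIV]]
    by (simp_all add: distinct_map)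
  have "thin_below (i - k + k) ?zs"
    using thin_below_map[OF strict_mono_on_add[of UNIV]] ys(5) by simp
  then have thin: "thin_below i ?zs" using ki by simp
  have gt: "\<forall>z\<in>set ?zs. k < z" unfolding zs(1) by simp
  then have "filter (\<lambda>y. y < 1) ?zs = []" "filter (\<lambda>y. y < Suc k) ?zs = []"
    by (auto simp: filter_empty_conv)
  then have thin1: "thin_below i (1 # ?zs)" "length (filter (\<lambda>y. y < Suc k) (1 # ?zs)) \<le> 1"
    using thin assms(1) by simp_all
  have thin2: "thin_below i (low_block k ys)"
    unfolding low_block_def by (rule thin_below_upt_append[OF thin1])
  have "run (i - k + k) ?zs = r - k"
    using run_map[OF strict_mono_on_add[of UNIV]] ys(6) by simp
  then have run: "run i ?zs = r - k" using ki by simp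
  show ?thesis
  proof (rule tailsI)
    show "distinct (low_block k ys)"
      using zs(2) gt assms(1) by (auto simp: low_block_def)
    show "set (low_block k ys) = {1..n} - {i}"
      unfolding low_block_def set_append list.set zs(1) using assms by auto
    show "good (low_block k ys)"
      unfolding low_block_def
    proof (rule good_appendI)
      show "good (1 # ?zs)" using zs(3) thin_below_mono[OF thin, of 1] ki by simp
      show "thin_below i ([2..<Suc k] @ 1 # ?zs)" using thin2 by (simp add: low_block_def)
    qed (use ki in auto)
    have "\<forall>x\<in>set ([2..<Suc k] @ [1]). x < i" using assms by auto
    from run_append_all[OF this, of ?zs] show "run i (low_block k ys) = r"
      using run assms(1,2) by (simp add: low_block_def del: upt_Suc)
  qed (use thin2 assms in auto)
qed

text \<open>Here the one permitted smaller entry is the old 1, which stands deeper in the list; it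
  exists because \<open>k + 1 < i\<close> makes the old last entry \<open>i - k\<close> at least
  2.\<close>

lemma above_one_block_in_tails:
  assumes "1 \<le> k" "k + 1 < i" "i \<le> n" "ys \<in> tails (n - k) (i - k) 1"
  shows "above_one_block k ys \<in> tails n i (k + 1)"
proof -
  let ?zs = "map (bump k) ys"
  note ys = tailsD[OF assms(4)]
  have bi: "bump k (i - k) = i" using assms by (simp add: bump_def)
  have zs: "set ?zs = insert 1 {k + 2..n} - {i}" "distinct ?zs" "good ?zs"
    using image_bump_tails[OF assms(2,3)] ys good_map[OF strict_mono_on_bump[of UNIV]]
      inj_on_subset[OF inj_bump]
    by (simp_all add: distinct_map)
  have "thin_below (bump k (i - k)) ?zs"
    using thin_below_map[OF strict_mono_on_bump[of UNIV]] ys(5) by simp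
  then have thin: "thin_below i ?zs" using bi by simp
  have "set (filter (\<lambda>y. y < k + 2) ?zs) \<subseteq> {1}"
    unfolding set_filter zs(1) by auto
  then have "card (set (filter (\<lambda>y. y < k + 2) ?zs)) \<le> card {1::nat}"
    by (rule card_mono[rotated]) simp
  then have "length (filter (\<lambda>y. y < k + 2) ?zs) \<le> 1"
    using distinct_card[OF distinct_filter[OF zs(2)]] by simp
  then have thin2: "thin_below i (above_one_block k ys)"
    unfolding above_one_block_def by (intro thin_below_upt_append thin)
  have "run (bump k (i - k)) ?zs = 1"
    using run_map[OF strict_mono_on_bump[of UNIV]] ys(6) by simp
  then have run: "run i ?zs = 1" using bi by simp
  show ?thesis
  proof (rule tailsI)
    show "distinct (above_one_block k ys)"
      unfolding above_one_block_def distinct_append zs(1) using zs(2) by auto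
    show "set (above_one_block k ys) = {1..n} - {i}"
      unfolding above_one_block_def set_append zs(1) using assms by auto
    show "good (above_one_block k ys)"
      unfolding above_one_block_def
      by (rule good_appendI[OF zs(3) thin2[unfolded above_one_block_def]]) (use assms in auto)
    show "run i (above_one_block k ys) = k + 1"
      using run_append_all[of "[2..<k + 2]" i ?zs] run assms(2)
      by (simp add: above_one_block_def del: upt_Suc)
  qed (use thin2 assms in auto)
qed

lemma weight_above_one_block:
  assumes "k + 1 < i" "ys \<in> tails (n - k) (i - k) 1"
  shows "weight (above_one_block k ys) = weight ys"
proof -
  have "weight (map (bump k) ys) = weight ys"
    by (rule weight_map[OF strict_mono_on_bump[of UNIV]]) simp
  moreover have "k + 2 \<le> Suc (bump k (hd ys))" if "ys \<noteq> []"
  proof -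
    \<comment> \<open>Run length 1 forces the head of \<open>ys\<close> to be at least
      \<open>i - k\<close>, hence at least 2, so \<open>bump\<close> lifts it above the whole
      block.\<close>
    have "\<not> hd ys < i - k"
      using that tailsD(6)[OF assms(2)] by (cases ys) (auto simp: run_def)
    then have "2 \<le> hd ys" using assms(1) by linarith
    then show ?thesis by (simp add: bump_def)
  qed
  ultimately show ?thesis
    unfolding above_one_block_def by (subst weight_upt_append) (auto simp: hd_map)
qed

lemma tails_cases:
  assumes "2 \<le> r" "r \<le> i" "i \<le> n" "us \<in> tails n i r"
  shows "(\<exists>k\<in>{1..r - 1}. \<exists>ys\<in>tails (n - k) (i - k) (r - k). us = low_block k ys) \<or>
    r < i \<and> (\<exists>ys\<in>tails (n - (r - 1)) (i - (r - 1)) 1. us = above_one_block (r - 1) ys)"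
proof -
  note us = tailsD[OF assms(4)]
  obtain xs zs where xs: "us = xs @ zs" "Suc (length xs) = r" "\<forall>x\<in>set xs. x < i"
    using assms(4) by (rule take_run)
  have one: "1 \<in> set us" unfolding us(2) using assms by auto
  have sus: "set us = insert 1 {2..n} - {i}" unfolding us(2) using assms by auto
  show ?thesis
  proof (cases "1 \<in> set xs")
    case True
    then obtain p q where pq: "xs = p @ 1 # q" by (meson split_list)
    define k where "k = Suc (length p)"
    define ws where "ws = q @ zs"
    have us_eq: "us = p @ 1 # ws" by (simp add: xs(1) pq ws_def)
    have k: "1 \<le> k" "k < r" "k < i" using xs(2) pq assms(2) by (auto simp: k_def)
    \<comment> \<open>The 1 counts as part of the rest here, so that the values in front of it in
      the list are forced to be 2 to \<open>k\<close>.\<close>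
    have pu: "p = [2..<2 + length p]"
      by (rule thin_below_prefix[of i p "1 # ws" 2 n]) (use us(1,5) sus us_eq xs(3) pq in auto)
    then have p: "p = [2..<Suc k]" by (simp add: k_def)
    have sp: "set p = {2..k}" unfolding p by auto
    have "set ws = set us - set (p @ [1])" using us(1) us_eq by auto
    also have "\<dots> = {k + 1..n} - {i}"
      unfolding us(2) set_append sp using k(1) by auto
    finally have "ws \<in> arrangements ((\<lambda>x. x + k) ` ({1..n - k} - {i - k}))"
      unfolding image_add_tails[OF k(3) assms(3)] using us(1) us_eq by (simp add: arrangements_def)
    also have "\<dots> = map (\<lambda>x. x + k) ` arrangements ({1..n - k} - {i - k})"
      by (rule arrangements_image) simp
    finally obtain ys where ys: "ws = map (\<lambda>x. x + k) ys" "ys \<in> arrangements ({1..n - k} - {i - k})"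
      by (rule imageE)
    have "ys \<in> tails (n - k) (i - k) (r - k)"
    proof (rule tailsI)
      show "distinct ys" "set ys = {1..n - k} - {i - k}" using ys(2) by (simp_all add: arrangements_def)
      show "i - k \<in> {1..n - k}" using k assms by auto
      have "good ws" using good_appendD[of "p @ [1]" ws] us(4) us_eq by simp
      then show "good ys" unfolding ys(1) using good_map[OF strict_mono_on_add[of UNIV]] by simp
      have "thin_below (i - k + k) ws"
        using thin_below_appendD[of i "p @ [1]" ws] us(5) us_eq k by simp
      then show "thin_below (i - k) ys"
        unfolding ys(1) using thin_below_map[OF strict_mono_on_add[of UNIV]] by simp
      have "run i us = k + run i ws"
        using run_append_all[of "p @ [1]" i ws] xs(3) pq us_eq by (simp add: k_def)
      also have "run i ws = run (i - k) ys"
        using run_map[OF strict_mono_on_add[of UNIV], of "i - k" ys k] k unfolding ys(1) by simp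
      finally show "run (i - k) ys = r - k" using us(6) by simp
    qed
    moreover have "us = low_block k ys"
      by (simp add: low_block_def us_eq ys(1) p)
    moreover have "k \<in> {1..r - 1}" using k by auto
    ultimately show ?thesis by blast
  next
    case False
    define k where "k = r - 1"
    have k: "1 \<le> k" "length xs = k" "r = k + 1" using xs(2) assms(1) by (auto simp: k_def)
    have "xs = [2..<2 + length xs]"
      by (rule thin_below_prefix[of i xs zs 2 n]) (use us(1,5) sus xs False one in auto)
    then have p: "xs = [2..<k + 2]" using k(2) by (simp add: add.commute)
    have sp: "set xs = {2..k + 1}" unfolding p by auto
    \<comment> \<open>The largest value \<open>k + 1 = r\<close> of the block lies in the run and so
      below \<open>i\<close>; this is where \<open>r < i\<close> comes from.\<close>
    then have "k + 1 \<in> set xs" using k(1) by simp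
    then have ki: "k + 1 < i" using xs(3) by blast
    have bi: "bump k (i - k) = i" using ki by (simp add: bump_def)
    have "set zs = set us - set xs" using us(1) xs(1) by auto
    also have "\<dots> = insert 1 {k + 2..n} - {i}"
      unfolding us(2) sp using assms by auto
    finally have "zs \<in> arrangements (bump k ` ({1..n - k} - {i - k}))"
      unfolding image_bump_tails[OF ki assms(3)] using us(1) xs(1) by (simp add: arrangements_def)
    also have "\<dots> = map (bump k) ` arrangements ({1..n - k} - {i - k})"
      by (rule arrangements_image) (rule inj_on_subset[OF inj_bump subset_UNIV])
    finally obtain ys where ys: "zs = map (bump k) ys" "ys \<in> arrangements ({1..n - k} - {i - k})"
      by (rule imageE)
    have "ys \<in> tails (n - k) (i - k) 1"
    proof (rule tailsI)
      show "distinct ys" "set ys = {1..n - k} - {i - k}" using ys(2) by (simp_all add: arrangements_def)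
      show "i - k \<in> {1..n - k}" using ki assms by auto
      have "good zs" using good_appendD[of xs zs] us(4) xs(1) by simp
      then show "good ys" unfolding ys(1) using good_map[OF strict_mono_on_bump[of UNIV]] by simp
      have "thin_below (bump k (i - k)) zs"
        using thin_below_appendD[of i xs zs] us(5) xs(1) bi by simp
      then show "thin_below (i - k) ys"
        unfolding ys(1) using thin_below_map[OF strict_mono_on_bump[of UNIV]] by simp
      have "run i us = k + run i zs"
        using run_append_all[of xs i zs] xs(1,3) k(2) by simp
      also have "run i zs = run (i - k) ys"
        using run_map[OF strict_mono_on_bump[of UNIV], of "i - k" ys k] bi unfolding ys(1) by simp
      finally show "run (i - k) ys = 1" using us(6) k(3) by simp
    qed
    moreover have "us = above_one_block k ys"
      by (simp add: above_one_block_def xs(1) ys(1) p)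
    ultimately show ?thesis using ki k(3) by auto
  qed
qed

lemma tail_weight_rec:
  assumes "2 \<le> r" "r \<le> i" "i \<le> n"
  shows "tail_weight n i r = tail_weight (n - 1) (i - 1) (r - 1) +
    (if r < i then tail_weight (n - r + 1) (i - r + 1) 1 else 0) +
    (\<Sum>k=2..r - 1. 2 * tail_weight (n - k) (i - k) (r - k))"
proof -
  define L where "L k = low_block k ` tails (n - k) (i - k) (r - k)" for k
  define U where "U = (if r < i then above_one_block (r - 1) ` tails (n - (r - 1)) (i - (r - 1)) 1 else {})"
  have eq: "tails n i r = (\<Union>k\<in>{1..r - 1}. L k) \<union> U"
  proof (intro equalityI subsetI)
    fix us assume "us \<in> tails n i r"
    from tails_cases[OF assms this] show "us \<in> (\<Union>k\<in>{1..r - 1}. L k) \<union> U"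
      by (auto simp: L_def U_def)
  next
    fix us assume "us \<in> (\<Union>k\<in>{1..r - 1}. L k) \<union> U"
    then show "us \<in> tails n i r"
    proof
      assume "us \<in> (\<Union>k\<in>{1..r - 1}. L k)"
      then obtain k ys where "k \<in> {1..r - 1}" "ys \<in> tails (n - k) (i - k) (r - k)" "us = low_block k ys"
        by (auto simp: L_def)
      then show ?thesis using low_block_in_tails[of k r i n ys] assms by auto
    next
      assume "us \<in> U"
      then obtain ys where "r < i" "ys \<in> tails (n - (r - 1)) (i - (r - 1)) 1" "us = above_one_block (r - 1) ys"
        by (auto simp: U_def split: if_splits)
      then show ?thesis using above_one_block_in_tails[of "r - 1" i n ys] assms by auto
    qed
  qed
  \<comment> \<open>The index of 1 in the list tells the pieces apart: it is \<open>k - 1\<close> on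
    \<open>L k\<close> and at least \<open>r - 1\<close> on \<open>U\<close>.\<close>
  define pos where "pos us = length (takeWhile (\<lambda>x. x \<noteq> 1) us)" for us :: "nat list"
  have posL: "pos us = k - 1" if "us \<in> L k" for us k
  proof -
    have "takeWhile (\<lambda>x. x \<noteq> 1) ([2..<Suc k] @ 1 # ys) = [2..<Suc k]" for ys
      by (subst takeWhile_append2) auto
    then show ?thesis using that by (auto simp: L_def pos_def low_block_def)
  qed
  have posU: "r - 1 \<le> pos us" if "us \<in> U" for us
  proof -
    have "takeWhile (\<lambda>x. x \<noteq> 1) ([2..<r - 1 + 2] @ ys) = [2..<r - 1 + 2] @ takeWhile (\<lambda>x. x \<noteq> 1) ys" for ys
      by (subst takeWhile_append2) auto
    then show ?thesis using that by (auto simp: U_def pos_def above_one_block_def split: if_splits)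
  qed
  have fin: "finite (L k)" "finite U" for k by (auto simp: L_def U_def)
  have disjL: "L k \<inter> L l = {}" if "k \<in> {1..r - 1}" "l \<in> {1..r - 1}" "k \<noteq> l" for k l
  proof (rule ccontr)
    assume "L k \<inter> L l \<noteq> {}"
    then obtain us where "us \<in> L k" "us \<in> L l" by blast
    then have "k - 1 = l - 1" using posL by metis
    then show False using that by auto
  qed
  have disjU: "(\<Union>k\<in>{1..r - 1}. L k) \<inter> U = {}"
  proof (rule ccontr)
    assume "(\<Union>k\<in>{1..r - 1}. L k) \<inter> U \<noteq> {}"
    then obtain us k where "k \<in> {1..r - 1}" "us \<in> L k" "us \<in> U" by blast
    then have "k \<in> {1..r - 1}" "r - 1 \<le> k - 1" using posL posU by fastforce+
    then show False by auto
  qed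
  have sumL: "sum weight (L k) = (if k = 1 then 1 else 2) * tail_weight (n - k) (i - k) (r - k)"
    if "k \<in> {1..r - 1}" for k
  proof -
    have "inj (low_block k)" by (auto simp: inj_def low_block_def inj_map_eq_map)
    then have "sum weight (L k) = (\<Sum>ys\<in>tails (n - k) (i - k) (r - k). weight (low_block k ys))"
      unfolding L_def by (subst sum.reindex) (auto intro: inj_on_subset)
    also have "\<dots> = (\<Sum>ys\<in>tails (n - k) (i - k) (r - k). (if k = 1 then 1 else 2) * weight ys)"
      using that by (intro sum.cong refl weight_low_block) (auto dest: tails_elems(1))
    finally show ?thesis by (simp add: tail_weight_def sum_distrib_left)
  qed
  have sumU: "sum weight U = (if r < i then tail_weight (n - r + 1) (i - r + 1) 1 else 0)"
  proof (cases "r < i")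
    case True
    have "inj (above_one_block (r - 1))"
      by (auto simp: inj_def above_one_block_def inj_map_eq_map[OF inj_bump])
    then have "sum weight U = (\<Sum>ys\<in>tails (n - (r - 1)) (i - (r - 1)) 1. weight (above_one_block (r - 1) ys))"
      using True unfolding U_def by (simp add: sum.reindex inj_on_subset)
    also have "\<dots> = (\<Sum>ys\<in>tails (n - (r - 1)) (i - (r - 1)) 1. weight ys)"
      using True assms by (intro sum.cong refl weight_above_one_block[of "r - 1" i]) auto
    also have "\<dots> = tail_weight (n - r + 1) (i - r + 1) 1"
      using True assms by (simp add: tail_weight_def Suc_diff_le)
    finally show ?thesis using True by simp
  qed (simp add: U_def)
  have "tail_weight n i r = (\<Sum>k\<in>{1..r - 1}. sum weight (L k)) + sum weight U"
  proof -
    have "sum weight (\<Union>k\<in>{1..r - 1}. L k) = (\<Sum>k\<in>{1..r - 1}. sum weight (L k))"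
      by (rule sum.UNION_disjoint) (use fin disjL in blast)+
    then show ?thesis
      unfolding tail_weight_def eq using fin disjU by (subst sum.union_disjoint) auto
  qed
  also have "(\<Sum>k\<in>{1..r - 1}. sum weight (L k)) =
      (\<Sum>k\<in>{1..r - 1}. (if k = 1 then 1 else 2) * tail_weight (n - k) (i - k) (r - k))"
    using sumL by simp
  \<comment> \<open>The term \<open>k = 1\<close> is separated because a block consisting of 1 alone
    lacks the factor 2.\<close>
  also have "{1..r - 1} = insert 1 {2..r - 1}" using assms by auto
  also have "(\<Sum>k\<in>insert 1 {2..r - 1}. (if k = 1 then 1 else 2) * tail_weight (n - k) (i - k) (r - k)) =
      tail_weight (n - 1) (i - 1) (r - 1) + (\<Sum>k=2..r - 1. 2 * tail_weight (n - k) (i - k) (r - k))"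
    by (simp add: sum.insert)
  finally show ?thesis using sumU by simp
qed

section \<open>Removing the last entry\<close>

definition skip :: "nat \<Rightarrow> nat \<Rightarrow> nat" where
  "skip i x = (if x < i then x else Suc x)"

lemma strict_mono_on_skip: "strict_mono_on A (skip i)"
  by (auto simp: strict_mono_on_def skip_def)

lemma inj_skip: "inj (skip i)"
  by (auto simp: inj_def skip_def split: if_splits)

lemma image_skip:
  assumes "i \<in> {1..n}"
  shows "skip i ` {1..n - 1} = {1..n} - {i}"
proof -
  have "y \<in> skip i ` {1..n - 1}" if "y \<in> {1..n} - {i}" for y
    by (rule image_eqI[of _ _ "if y < i then y else y - 1"]) (use that assms in \<open>auto simp: skip_def\<close>)
  moreover have "skip i ` {1..n - 1} \<subseteq> {1..n} - {i}"
    using assms by (auto simp: skip_def)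
  ultimately show ?thesis by blast
qed

text \<open>A run of length 1 means that the previous last entry, after relabelling, exceeds
  \<open>i\<close>. Its own thinness condition then already covers every entry below
  \<open>i\<close>, so appending \<open>i\<close> imposes nothing new.\<close>

lemma tails_one_eq:
  assumes "2 \<le> n" "i \<in> {1..n}"
  shows "tails n i 1 = map (skip i) ` {ys \<in> good_perms (n - 1). i \<le> hd ys}"
proof (intro equalityI subsetI)
  fix us assume us: "us \<in> tails n i 1"
  note u = tailsD[OF us]
  have ne: "us \<noteq> []" using u(7) assms(1) by auto
  have "us \<in> arrangements (skip i ` {1..n - 1})"
    unfolding image_skip[OF assms(2)] using u(1,2) by (simp add: arrangements_def)
  also have "\<dots> = map (skip i) ` arrangements {1..n - 1}"
    by (rule arrangements_image) (rule inj_on_subset[OF inj_skip subset_UNIV])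
  finally obtain ys where ys: "us = map (skip i) ys" "ys \<in> arrangements {1..n - 1}"
    by (rule imageE)
  have "good ys" using u(4) unfolding ys(1) good_map[OF strict_mono_on_skip[of UNIV] subset_UNIV] .
  moreover have "i \<le> hd ys"
    using u(6) ne unfolding ys(1) by (cases ys) (auto simp: run_def skip_def split: if_splits)
  ultimately show "us \<in> map (skip i) ` {ys \<in> good_perms (n - 1). i \<le> hd ys}"
    using ys by (auto simp: good_perms_def)
next
  fix us assume "us \<in> map (skip i) ` {ys \<in> good_perms (n - 1). i \<le> hd ys}"
  then obtain ys where ys: "us = map (skip i) ys" "distinct ys" "set ys = {1..n - 1}" "good ys" "i \<le> hd ys"
    by (auto simp: good_perms_def arrangements_def)
  have "ys \<noteq> []" using ys(3) assms(1) by auto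
  then obtain y zs where yz: "ys = y # zs" by (cases ys) auto
  then have y: "i \<le> y" "skip i y = Suc y" using ys(5) by (simp_all add: skip_def)
  have "thin_below (skip i y) (map (skip i) zs)"
    using ys(4) thin_below_map[OF strict_mono_on_skip[of UNIV]] yz by simp
  then have thin: "thin_below i (map (skip i) zs)"
    by (rule thin_below_mono) (use y in simp)
  show "us \<in> tails n i 1"
  proof (rule tailsI)
    show "distinct us" unfolding ys(1) distinct_map
      using ys(2) inj_on_subset[OF inj_skip subset_UNIV] by blast
    show "set us = {1..n} - {i}" unfolding ys(1) set_map ys(3) by (rule image_skip[OF assms(2)])
    show "good us" using ys(1,4) good_map[OF strict_mono_on_skip[of UNIV]] by simp
    show "thin_below i us" using thin y ys(1) yz by simp
    show "run i us = 1" using y ys(1) yz by (simp add: run_def)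
  qed (use assms(2) in simp)
qed

lemma good_perms_hd:
  assumes "xs \<in> good_perms n" "1 \<le> n"
  shows "xs \<noteq> []" "hd xs \<in> {1..n}"
proof -
  have s: "set xs = {1..n}" using assms(1) by (simp add: good_perms_def arrangements_def)
  then show "xs \<noteq> []" using assms(2) by auto
  from hd_in_set[OF this] show "hd xs \<in> {1..n}" unfolding s .
qed

lemma tail_weight_one:
  assumes "2 \<le> n" "i \<in> {1..n}"
  shows "tail_weight n i 1 = (\<Sum>j=i..n - 1. good_weight_last (n - 1) j)"
proof -
  let ?S = "{ys \<in> good_perms (n - 1). i \<le> hd ys}"
  have "tail_weight n i 1 = (\<Sum>ys\<in>?S. weight (map (skip i) ys))"
    unfolding tail_weight_def tails_one_eq[OF assms]
    by (subst sum.reindex) (auto intro!: inj_on_subset[OF inj_mapI] inj_skip)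
  also have "\<dots> = sum weight ?S"
    by (rule sum.cong[OF refl weight_map[OF strict_mono_on_skip[of UNIV]]]) simp
  also have "\<dots> = (\<Sum>j=i..n - 1. sum weight {ys \<in> ?S. hd ys = j})"
  proof (rule sum.group[symmetric])
    show "hd ` ?S \<subseteq> {i..n - 1}" using good_perms_hd(2)[of _ "n - 1"] assms(1) by force
  qed simp_all
  also have "\<dots> = (\<Sum>j=i..n - 1. good_weight_last (n - 1) j)"
    unfolding good_weight_last_def by (intro sum.cong refl arg_cong[where f = "sum weight"]) auto
  finally show ?thesis .
qed

lemma sum_weight_hd_run:
  assumes "1 \<le> n"
  shows "(\<Sum>xs | xs \<in> good_perms n \<and> hd xs = i \<and> run (hd xs) (tl xs) = r. weight xs) = r * tail_weight n i r"
proof -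
  have "{xs. xs \<in> good_perms n \<and> hd xs = i \<and> run (hd xs) (tl xs) = r} = (#) i ` tails n i r"
  proof (intro equalityI subsetI)
    fix xs assume xs: "xs \<in> {xs. xs \<in> good_perms n \<and> hd xs = i \<and> run (hd xs) (tl xs) = r}"
    then have "xs = i # tl xs" using good_perms_hd[of xs n] assms by (cases xs) auto
    then show "xs \<in> (#) i ` tails n i r" using xs by (auto simp: tails_def)
  qed (auto simp: tails_def)
  then have "(\<Sum>xs | xs \<in> good_perms n \<and> hd xs = i \<and> run (hd xs) (tl xs) = r. weight xs) =
      (\<Sum>ys\<in>tails n i r. weight (i # ys))"
    by (simp add: sum.reindex)
  also have "\<dots> = (\<Sum>ys\<in>tails n i r. r * weight ys)"
    by (rule sum.cong) (auto simp: tails_def)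
  finally show ?thesis by (simp add: tail_weight_def sum_distrib_left)
qed

lemma good_weight_last_eq:
  assumes "1 \<le> n"
  shows "good_weight_last n i = (\<Sum>r=1..i. r * tail_weight n i r)"
proof -
  let ?S = "{xs. xs \<in> good_perms n \<and> hd xs = i}"
  have rng: "run (hd xs) (tl xs) \<in> {1..i}" if "xs \<in> ?S" for xs
  proof -
    have "xs = i # tl xs" using that good_perms_hd[of xs n] assms by (cases xs) auto
    then have "tl xs \<in> tails n i (run i (tl xs))" using that by (simp add: tails_def)
    then have "tails n i (run i (tl xs)) \<noteq> {}" by blast
    then show ?thesis using tails_empty[of "run i (tl xs)" i n] that by auto
  qed
  have "good_weight_last n i = (\<Sum>r=1..i. sum weight {xs \<in> ?S. run (hd xs) (tl xs) = r})"
    unfolding good_weight_last_def by (rule sum.group[symmetric]) (use rng in auto)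
  also have "\<dots> = (\<Sum>r=1..i. r * tail_weight n i r)"
    using sum_weight_hd_run[OF assms] by (simp add: conj_ac)
  finally show ?thesis .
qed

lemma good_weight_eq:
  assumes "1 \<le> n"
  shows "good_weight n = (\<Sum>i=1..n. good_weight_last n i)"
proof -
  have "good_weight n = (\<Sum>i=1..n. sum weight {xs \<in> good_perms n. hd xs = i})"
    unfolding good_weight_def by (rule sum.group[symmetric]) (use good_perms_hd assms in auto)
  then show ?thesis by (simp add: good_weight_last_def)
qed

lemma good_weight_0: "good_weight 0 = 1"
proof -
  have "good_perms 0 = {[]}" by (auto simp: good_perms_def arrangements_def)
  then show ?thesis by (simp add: good_weight_def)
qed

lemma tail_weight_eq_0: "\<not> (1 \<le> r \<and> r \<le> i \<and> i \<le> n) \<Longrightarrow> tail_weight n i r = 0"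
  using tails_empty[of r i n] by (simp add: tail_weight_def)

lemma tail_weight_1: "tail_weight 1 1 1 = 1"
proof -
  have "[] \<in> tails 1 1 1" by (rule tailsI) (auto simp: run_def)
  moreover have "ys = []" if "ys \<in> tails 1 1 1" for ys using tailsD(7)[OF that] by simp
  ultimately have "tails 1 1 1 = {[]}" by blast
  then show ?thesis by (simp add: tail_weight_def)
qed

text \<open>When the largest value comes last, its run is the whole permutation, so only
  \<open>r = n\<close> contributes.\<close>

lemma good_weight_last_diagonal: "1 \<le> n \<Longrightarrow> good_weight_last n n = n * tail_weight n n n"
proof -
  assume n: "1 \<le> n"
  have "tail_weight n n r = 0" if "r \<in> {1..n} - {n}" for r
  proof -
    have "tails n n r = {}"
    proof (rule equals0I)
      fix ys assume ys: "ys \<in> tails n n r"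
      have "run n ys = Suc (length ys)"
        by (rule run_less_all) (use tails_elems[OF ys] in force)
      then show False using tailsD(6,7)[OF ys] that by auto
    qed
    then show ?thesis by (simp add: tail_weight_def)
  qed
  then have "good_weight_last n n = (\<Sum>r\<in>{n}. r * tail_weight n n r)"
    unfolding good_weight_last_eq[OF n] by (intro sum.mono_neutral_right) (use n in auto)
  then show ?thesis by simp
qed

section \<open>Parking functions as weighted permutations\<close>

lemma ell_append:
  assumes "s \<in> {1..length \<tau>}"
  shows "ell (\<tau> @ [x]) s = ell \<tau> s"
proof -
  have "{k. 1 \<le> k \<and> k \<le> s \<and> (\<forall>j\<in>{s - k + 1..s}. entry (\<tau> @ [x]) j \<le> entry (\<tau> @ [x]) s)} =
      {k. 1 \<le> k \<and> k \<le> s \<and> (\<forall>j\<in>{s - k + 1..s}. entry \<tau> j \<le> entry \<tau> s)}"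
    using assms by (auto simp: entry_append)
  then show ?thesis by (simp only: ell_def)
qed

text \<open>\<open>ell\<close> compares by "at most" and \<open>run\<close> by "less than"; they
  agree because \<open>x\<close> does not occur in \<open>\<tau>\<close>.\<close>

lemma ell_last:
  assumes "x \<notin> set \<tau>"
  shows "ell (\<tau> @ [x]) (Suc (length \<tau>)) = run x (rev \<tau>)"
proof -
  let ?n = "length \<tau>" and ?\<pi> = "\<tau> @ [x]"
  define t where "t = length (takeWhile (\<lambda>y. y < x) (rev \<tau>))"
  have t: "t \<le> ?n" unfolding t_def using length_takeWhile_le[of _ "rev \<tau>"] by simp
  have last: "entry ?\<pi> (Suc ?n) = x" by (simp add: entry_def)
  have ent: "entry ?\<pi> j = rev \<tau> ! (?n - j)" if "1 \<le> j" "j \<le> ?n" for j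
    using that by (simp add: entry_append) (simp add: entry_def rev_nth Suc_diff_Suc)
  have 1: "1 \<le> Suc ?n" by simp
  note bounds = ell_bounds[OF 1, where \<pi> = ?\<pi>]
  note iff = le_ell_iff[OF 1, where \<pi> = ?\<pi>, unfolded last]
  have "ell ?\<pi> (Suc ?n) \<le> Suc t"
  proof (rule ccontr)
    assume "\<not> ell ?\<pi> (Suc ?n) \<le> Suc t"
    then have p: "1 \<le> ?n - t" "Suc ?n < ?n - t + ell ?\<pi> (Suc ?n)" "t < ?n"
      using bounds by auto
    \<comment> \<open>A window longer than \<open>Suc t\<close> would reach position
      \<open>?n - t\<close>, which holds the first entry rejected by
      \<open>takeWhile\<close>.\<close>
    then have "entry ?\<pi> (?n - t) \<le> x" using iff[of "?n - t"] by auto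
    moreover have "entry ?\<pi> (?n - t) = rev \<tau> ! t" using ent[of "?n - t"] p by simp
    moreover have "\<not> rev \<tau> ! t < x"
      using nth_length_takeWhile[of "\<lambda>y. y < x" "rev \<tau>"] p(3) by (simp add: t_def)
    ultimately have "rev \<tau> ! t = x" by simp
    then show False using assms p(3) nth_mem[of t "rev \<tau>"] by simp
  qed
  moreover have "entry ?\<pi> j \<le> x" if "j \<in> {Suc ?n - t..Suc ?n}" for j
  proof (cases "j = Suc ?n")
    case False
    then have j: "1 \<le> j" "j \<le> ?n" "?n - j < t" using that t by auto
    then have "takeWhile (\<lambda>y. y < x) (rev \<tau>) ! (?n - j) = entry ?\<pi> j"
      using ent[OF j(1,2)] takeWhile_nth[of "?n - j"] by (simp add: t_def)
    moreover have "takeWhile (\<lambda>y. y < x) (rev \<tau>) ! (?n - j) \<in> set (takeWhile (\<lambda>y. y < x) (rev \<tau>))"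
      by (rule nth_mem) (use j(3) in \<open>simp add: t_def\<close>)
    ultimately show ?thesis using set_takeWhileD by fastforce
  qed (simp add: last)
  then have "Suc ?n < Suc ?n - t + ell ?\<pi> (Suc ?n)"
    using iff[of "Suc ?n - t"] t by simp
  ultimately show ?thesis using t by (simp add: run_def t_def)
qed

lemma weight_rev: "distinct \<pi> \<Longrightarrow> weight (rev \<pi>) = (\<Prod>s=1..length \<pi>. ell \<pi> s)"
proof (induction \<pi> rule: rev_induct)
  case (snoc x \<tau>)
  have "(\<Prod>s=1..length \<tau>. ell (\<tau> @ [x]) s) = (\<Prod>s=1..length \<tau>. ell \<tau> s)"
    by (rule prod.cong) (auto simp: ell_append)
  then show ?case using snoc ell_last[of x \<tau>] by simp
qed simp

section \<open>Pattern avoidance in terms of positions\<close>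

lemma length_filter_le_1_iff:
  "length (filter P xs) \<le> 1 \<longleftrightarrow> (\<forall>a b. a < b \<and> b < length xs \<longrightarrow> \<not> (P (xs ! a) \<and> P (xs ! b)))"
proof -
  have "length (filter P xs) \<le> 1 \<longleftrightarrow> card {i. i < length xs \<and> P (xs ! i)} \<le> Suc 0"
    by (simp add: length_filter_conv_card)
  also have "\<dots> \<longleftrightarrow> (\<forall>a\<in>{i. i < length xs \<and> P (xs ! i)}. \<forall>b\<in>{i. i < length xs \<and> P (xs ! i)}. a = b)"
    by (rule card_le_Suc0_iff_eq) simp
  also have "\<dots> \<longleftrightarrow> (\<forall>a b. a < b \<and> b < length xs \<longrightarrow> \<not> (P (xs ! a) \<and> P (xs ! b)))"
    by (auto dest: less_trans) (metis nat_neq_iff)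
  finally show ?thesis .
qed

lemma thin_below_rev_iff:
  "thin_below v (rev \<pi>) \<longleftrightarrow>
    (\<forall>c<length \<pi>. \<pi> ! c < v \<longrightarrow> (\<forall>a b. a < b \<and> b < c \<longrightarrow> \<not> (\<pi> ! a < \<pi> ! c \<and> \<pi> ! b < \<pi> ! c)))"
proof (induction \<pi> rule: rev_induct)
  case (snoc x \<tau>)
  have "length (filter (\<lambda>y. y < x) (rev \<tau>)) = length (filter (\<lambda>y. y < x) \<tau>)"
    by (simp add: rev_filter[symmetric])
  then show ?case
    using snoc length_filter_le_1_iff[of "\<lambda>y. y < x" \<tau>]
    by (simp add: nth_append less_Suc_eq all_conj_distrib imp_conjR disj_imp)
qed simp

lemma good_rev_iff:
  "good (rev \<pi>) \<longleftrightarrow>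
    (\<forall>d<length \<pi>. \<forall>c<d. \<pi> ! c < \<pi> ! d \<longrightarrow>
      (\<forall>a b. a < b \<and> b < c \<longrightarrow> \<not> (\<pi> ! a < \<pi> ! c \<and> \<pi> ! b < \<pi> ! c)))"
proof (induction \<pi> rule: rev_induct)
  case (snoc x \<tau>)
  show ?case
    using snoc thin_below_rev_iff[of x \<tau>]
    by (simp add: nth_append less_Suc_eq all_conj_distrib imp_conjR disj_imp)
qed simp

lemma contains_pattern_4:
  assumes "length \<sigma> = 4"
  shows "contains_pattern \<pi> \<sigma> \<longleftrightarrow>
    (\<exists>a b c d. a < b \<and> b < c \<and> c < d \<and> d < length \<pi> \<and>
      (\<forall>i<4. \<forall>j<4. \<pi> ! ([a, b, c, d] ! i) < \<pi> ! ([a, b, c, d] ! j) \<longleftrightarrow> \<sigma> ! i < \<sigma> ! j))"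
proof
  assume "contains_pattern \<pi> \<sigma>"
  then obtain f where f: "strict_mono_on {..<4::nat} f" "f ` {..<4} \<subseteq> {..<length \<pi>}"
    "\<forall>i<4. \<forall>j<4. \<pi> ! f i < \<pi> ! f j \<longleftrightarrow> \<sigma> ! i < \<sigma> ! j"
    by (auto simp: contains_pattern_def assms)
  have "[f 0, f 1, f 2, f 3] ! i = f i" if "i < 4" for i
    using that by (auto simp: less_Suc_eq numeral_eq_Suc)
  moreover have "f 0 < f 1" "f 1 < f 2" "f 2 < f 3"
    using f(1) by (auto simp: strict_mono_on_def)
  moreover have "f 3 < length \<pi>" using f(2) by (simp add: image_subset_iff)
  ultimately show "\<exists>a b c d. a < b \<and> b < c \<and> c < d \<and> d < length \<pi> \<and>
      (\<forall>i<4. \<forall>j<4. \<pi> ! ([a, b, c, d] ! i) < \<pi> ! ([a, b, c, d] ! j) \<longleftrightarrow> \<sigma> ! i < \<sigma> ! j)"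
    using f(3) by (intro exI[of _ "f 0"] exI[of _ "f 1"] exI[of _ "f 2"] exI[of _ "f 3"]) simp
next
  assume "\<exists>a b c d. a < b \<and> b < c \<and> c < d \<and> d < length \<pi> \<and>
      (\<forall>i<4. \<forall>j<4. \<pi> ! ([a, b, c, d] ! i) < \<pi> ! ([a, b, c, d] ! j) \<longleftrightarrow> \<sigma> ! i < \<sigma> ! j)"
  then obtain a b c d where *: "a < b" "b < c" "c < d" "d < length \<pi>"
    "\<forall>i<4. \<forall>j<4. \<pi> ! ([a, b, c, d] ! i) < \<pi> ! ([a, b, c, d] ! j) \<longleftrightarrow> \<sigma> ! i < \<sigma> ! j" by blast
  have "strict_mono_on {..<4} ((!) [a, b, c, d])"
    using *(1-3) by (auto simp: strict_mono_on_def less_Suc_eq numeral_eq_Suc)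
  moreover have "(!) [a, b, c, d] ` {..<4} \<subseteq> {..<length \<pi>}"
    using *(1-4) by (auto simp: less_Suc_eq numeral_eq_Suc)
  ultimately show "contains_pattern \<pi> \<sigma>"
    using *(5) unfolding contains_pattern_def assms by blast
qed

lemma all_less_4: "(\<forall>i<4::nat. P i) \<longleftrightarrow> P 0 \<and> P 1 \<and> P 2 \<and> P 3"
  by (auto simp: less_Suc_eq numeral_eq_Suc)

text \<open>The patterns differ only in the order of their first two entries, so avoiding both
  forbids any two smaller entries in front of a pair c < d, in whichever order they stand.\<close>

lemma avoids_iff_good:
  assumes "distinct \<pi>"
  shows "avoids \<pi> [1, 2, 3, 4] \<and> avoids \<pi> [2, 1, 3, 4] \<longleftrightarrow> good (rev \<pi>)"
proof
  assume av: "avoids \<pi> [1, 2, 3, 4] \<and> avoids \<pi> [2, 1, 3, 4]"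
  show "good (rev \<pi>)" unfolding good_rev_iff
  proof (intro allI impI notI)
    fix d c a b
    assume *: "d < length \<pi>" "c < d" "\<pi> ! c < \<pi> ! d" "a < b \<and> b < c" "\<pi> ! a < \<pi> ! c \<and> \<pi> ! b < \<pi> ! c"
    have ne: "\<pi> ! a \<noteq> \<pi> ! b" using nth_eq_iff_index_eq[OF assms] * by auto
    have "contains_pattern \<pi> (if \<pi> ! a < \<pi> ! b then [1, 2, 3, 4] else [2, 1, 3, 4])"
      by (subst contains_pattern_4, simp, rule exI[of _ a], rule exI[of _ b], rule exI[of _ c], rule exI[of _ d])
        (use * ne in \<open>auto simp: all_less_4\<close>)
    then show False using av by (simp add: avoids_def split: if_splits)
  qed
next
  assume g: "good (rev \<pi>)"
  have "\<not> contains_pattern \<pi> \<sigma>" if "\<sigma> = [1, 2, 3, 4] \<or> \<sigma> = [2, 1, 3, 4]" for \<sigma>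
  proof
    assume cp: "contains_pattern \<pi> \<sigma>"
    have "length \<sigma> = 4" using that by auto
    from cp[unfolded contains_pattern_4[OF this]]
    obtain a b c d where pos: "a < b" "b < c" "c < d" "d < length \<pi>"
      and ord: "\<forall>i<4. \<forall>j<4. \<pi> ! ([a, b, c, d] ! i) < \<pi> ! ([a, b, c, d] ! j) \<longleftrightarrow> \<sigma> ! i < \<sigma> ! j"
      by blast
    have "\<pi> ! a < \<pi> ! c" "\<pi> ! b < \<pi> ! c" "\<pi> ! c < \<pi> ! d"
      using ord[rule_format, of 0 2] ord[rule_format, of 1 2] ord[rule_format, of 2 3] that by auto
    then show False using g pos unfolding good_rev_iff by blast
  qed
  then show "avoids \<pi> [1, 2, 3, 4] \<and> avoids \<pi> [2, 1, 3, 4]" by (simp add: avoids_def)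
qed

text \<open>The property \<open>Q\<close> is arbitrary so that all three counts \<open>pk\<close>,
  \<open>pk2\<close> and \<open>pk3\<close> are instances.\<close>

lemma card_PK_filter:
  "card {as \<in> PK n. Q (parking_permutation as)} = (\<Sum>xs | xs \<in> good_perms n \<and> Q (rev xs). weight xs)"
proof -
  define S where "S = {xs \<in> good_perms n. Q (rev xs)}"
  define F where "F \<pi> = {as \<in> parking_functions n. parking_permutation as = \<pi>}" for \<pi>
  have S: "distinct xs" "set xs = {1..n}" "good xs" "length xs = n" if "xs \<in> S" for xs
    using that distinct_card[of xs] by (auto simp: S_def good_perms_def arrangements_def)
  have "{as \<in> PK n. Q (parking_permutation as)} = (\<Union>xs\<in>S. F (rev xs))"
  proof (intro equalityI subsetI)
    fix as assume as: "as \<in> {as \<in> PK n. Q (parking_permutation as)}"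
    then have pf: "as \<in> parking_functions n" by (simp add: PK_def)
    note \<pi> = parking_function_street[OF pf]
    have "rev (parking_permutation as) \<in> S"
      using as \<pi>(1,2) avoids_iff_good[OF \<pi>(1)]
      by (simp add: S_def PK_def good_perms_def arrangements_def)
    then show "as \<in> (\<Union>xs\<in>S. F (rev xs))" using pf by (force simp: F_def)
  next
    fix as assume "as \<in> (\<Union>xs\<in>S. F (rev xs))"
    then obtain xs where "xs \<in> S" "as \<in> F (rev xs)" by blast
    then show "as \<in> {as \<in> PK n. Q (parking_permutation as)}"
      using avoids_iff_good[of "rev xs"] S by (auto simp: F_def PK_def S_def)
  qed
  also have "card (\<Union>xs\<in>S. F (rev xs)) = (\<Sum>xs\<in>S. card (F (rev xs)))"
  proof (rule card_UN_disjoint)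
    show "finite S" by (simp add: S_def)
    have "finite (parking_functions n)"
      by (rule finite_subset[OF _ finite_lists_length_eq[of "{1..n}" n]]) (auto simp: parking_functions_def)
    then show "\<forall>xs\<in>S. finite (F (rev xs))" by (simp add: F_def)
  qed (auto simp: F_def)
  also have "\<dots> = (\<Sum>xs\<in>S. weight xs)"
  proof (rule sum.cong[OF refl])
    fix xs assume xs: "xs \<in> S"
    show "card (F (rev xs)) = weight xs"
      using card_parking_fibre[of "rev xs" n] weight_rev[of "rev xs"] S[OF xs] by (simp add: F_def)
  qed
  finally show ?thesis by (simp add: S_def)
qed

lemma pk_eq: "pk n = good_weight n"
proof (cases "n = 0")
  case False
  then show ?thesis using card_PK_filter[of n "\<lambda>_. True"] by (simp add: pk_def good_weight_def)
qed (simp add: pk_def good_weight_0)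

lemma good_perms_last:
  assumes "xs \<in> good_perms n" "1 \<le> n"
  shows "entry (rev xs) n = hd xs" "ell (rev xs) n = run (hd xs) (tl xs)"
proof -
  obtain y ys where xs: "xs = y # ys" using good_perms_hd(1)[OF assms] by (cases xs) auto
  have d: "distinct xs" "set xs = {1..n}" using assms(1) by (auto simp: good_perms_def arrangements_def)
  then have "length xs = n" using distinct_card[OF d(1)] by simp
  then have n: "n = Suc (length ys)" by (simp add: xs)
  show "entry (rev xs) n = hd xs" by (simp add: xs n entry_def nth_append)
  show "ell (rev xs) n = run (hd xs) (tl xs)"
    using ell_last[of y "rev ys"] d(1) by (simp add: xs n)
qed

lemma pk2_eq: "1 \<le> n \<Longrightarrow> pk2 n (int i) = good_weight_last n i"
proof -
  assume n: "1 \<le> n"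
  have "{xs. xs \<in> good_perms n \<and> int (entry (rev xs) n) = int i} = {xs. xs \<in> good_perms n \<and> hd xs = i}"
    using good_perms_last(1)[OF _ n] by auto
  then show ?thesis
    using card_PK_filter[of n "\<lambda>\<pi>. int (entry \<pi> n) = int i"] by (simp add: pk2_def good_weight_last_def)
qed

lemma pk3_eq:
  assumes "1 \<le> n"
  shows "pk3 n i r = (if 0 \<le> i \<and> 0 \<le> r then nat r * tail_weight n (nat i) (nat r) else 0)"
proof -
  have "{xs. xs \<in> good_perms n \<and> int (entry (rev xs) n) = i \<and> int (ell (rev xs) n) = r} =
      (if 0 \<le> i \<and> 0 \<le> r then {xs. xs \<in> good_perms n \<and> hd xs = nat i \<and> run (hd xs) (tl xs) = nat r} else {})"
    using good_perms_last[OF _ assms] by auto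
  then show ?thesis
    using card_PK_filter[of n "\<lambda>\<pi>. int (entry \<pi> n) = i \<and> int (ell \<pi> n) = r"]
      sum_weight_hd_run[OF assms, of "nat i" "nat r"]
    by (simp add: pk3_def)
qed

section \<open>Numerical values\<close>

text \<open>Iterating the block removal reduces a last run of length \<open>r < i\<close> to one of length \<open>1\<close>, always
  removing \<open>r - 1\<close> entries in total; the weights of the ways to do so add up to a Pell number.\<close>

fun pell :: "nat \<Rightarrow> nat" where
  "pell 0 = 0"
| "pell (Suc 0) = 1"
| "pell (Suc (Suc n)) = 2 * pell (Suc n) + pell n"

text \<open>Shaped like \<open>tail_weight_rec\<close> for \<open>r = m + 2\<close>: the terms stand
  for removing 1 alone, removing r, ..., 3, 2, and removing 1 together with k, ..., 2.\<close>

lemma pell_sum: "pell (Suc (Suc m)) = pell (Suc m) + 1 + 2 * (\<Sum>j\<le>m. pell j)"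
  by (induction m) auto

lemma sum_reverse_from_2: "(\<Sum>k=2..Suc m. f (Suc (Suc m) - k)) = (\<Sum>j=1..m. f j)"
  for f :: "nat \<Rightarrow> nat"
  by (rule sum.reindex_bij_witness[of _ "\<lambda>j. Suc (Suc m) - j" "\<lambda>k. Suc (Suc m) - k"]) auto

lemma tail_weight_off_diagonal:
  assumes "1 \<le> r" "r < i" "i \<le> n"
  shows "tail_weight n i r = pell r * tail_weight (n - r + 1) (i - r + 1) 1"
  using assms
proof (induction r arbitrary: n i rule: less_induct)
  case (less r)
  show ?case
  proof (cases "r = 1")
    case False
    then obtain m where m: "r = Suc (Suc m)" using less.prems(1)
      by (metis One_nat_def Suc_le_D old.nat.exhaust)
    let ?t = "tail_weight (n - r + 1) (i - r + 1) 1"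
    \<comment> \<open>A removal lowers \<open>n\<close>, \<open>i\<close> and \<open>r\<close>
      alike, so every term of the recurrence leads to the same \<open>?t\<close>.\<close>
    have IH: "tail_weight (n - k) (i - k) (r - k) = pell (r - k) * ?t" if "1 \<le> k" "k < r" for k
      using less.IH[of "r - k" "i - k" "n - k"] less.prems that by (simp add: m)
    have "tail_weight n i r = tail_weight (n - 1) (i - 1) (r - 1) + ?t + (\<Sum>k=2..r - 1. 2 * tail_weight (n - k) (i - k) (r - k))"
      using tail_weight_rec[of r i n] less.prems m by simp
    also have "(\<Sum>k=2..r - 1. 2 * tail_weight (n - k) (i - k) (r - k)) = (\<Sum>k=2..r - 1. 2 * ?t * pell (r - k))"
      by (rule sum.cong[OF refl]) (subst IH, auto)
    also have "\<dots> = 2 * ?t * (\<Sum>k=2..Suc m. pell (Suc (Suc m) - k))"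
      unfolding sum_distrib_left m by simp
    also have "(\<Sum>k=2..Suc m. pell (Suc (Suc m) - k)) = (\<Sum>j=1..m. pell j)"
      by (rule sum_reverse_from_2)
    also have "\<dots> = (\<Sum>j\<le>m. pell j)"
      by (rule sum.mono_neutral_left) (auto simp: not_less_eq_eq)
    also have "tail_weight (n - 1) (i - 1) (r - 1) = pell (Suc m) * ?t" using IH[of 1] by (simp add: m)
    finally have "tail_weight n i r = pell (Suc m) * ?t + ?t + 2 * ?t * (\<Sum>j\<le>m. pell j)" .
    also have "\<dots> = pell r * ?t" unfolding m pell_sum by (simp add: algebra_simps)
    finally show ?thesis .
  qed (use less.prems in simp)
qed

lemma tail_weight_diagonal_rec: "tail_weight (Suc (Suc m)) (Suc (Suc m)) (Suc (Suc m)) =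
    tail_weight (Suc m) (Suc m) (Suc m) + 2 * (\<Sum>j=1..m. tail_weight j j j)"
proof -
  have "tail_weight (Suc (Suc m)) (Suc (Suc m)) (Suc (Suc m)) =
      tail_weight (Suc m) (Suc m) (Suc m) + 2 * (\<Sum>k=2..Suc m. (\<lambda>j. tail_weight j j j) (Suc (Suc m) - k))"
    using tail_weight_rec[of "Suc (Suc m)" "Suc (Suc m)" "Suc (Suc m)"] by (simp add: sum_distrib_left)
  then show ?thesis by (simp only: sum_reverse_from_2[of "\<lambda>j. tail_weight j j j"])
qed

text \<open>These are the half-companion Pell numbers 1, 3, 7, 17, .... Subtracting consecutive
  instances of \<open>tail_weight_diagonal_rec\<close> cancels the sum and leaves the Pell
  recurrence.\<close>

lemma tail_weight_diagonal_pell: "tail_weight (Suc (Suc m)) (Suc (Suc m)) (Suc (Suc m)) = pell (Suc m) + pell m"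
proof (induction m rule: less_induct)
  case (less m)
  consider "m = 0" | "m = 1" | k where "m = Suc (Suc k)"
    by (metis One_nat_def not0_implies_Suc)
  then show ?case
  proof cases
    case 1
    then show ?thesis using tail_weight_diagonal_rec[of 0] tail_weight_1 by simp
  next
    case 2
    then show ?thesis using tail_weight_diagonal_rec[of 0] tail_weight_diagonal_rec[of 1] tail_weight_1 by simp
  next
    case 3
    then show ?thesis
      using tail_weight_diagonal_rec[of "Suc (Suc k)"] tail_weight_diagonal_rec[of "Suc k"] less.IH[of k] less.IH[of "Suc k"]
      by simp
  qed
qed

text \<open>By \<open>tail_weight_one\<close> this is \<open>tail_weight (Suc n) i 1\<close> for
  \<open>n \<ge> 1\<close> and \<open>1 \<le> i \<le> n + 1\<close>, the only off-diagonal quantity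
  left after the Pell reduction.\<close>

definition upper_sum :: "nat \<Rightarrow> nat \<Rightarrow> nat" where
  "upper_sum n i = (\<Sum>j=i..n. good_weight_last n j)"

lemma good_weight_eq_upper_sum: "1 \<le> n \<Longrightarrow> good_weight n = upper_sum n 1"
  by (simp add: good_weight_eq upper_sum_def)

lemma upper_sum_gt: "n < i \<Longrightarrow> upper_sum n i = 0"
  by (simp add: upper_sum_def)

lemma good_weight_last_rec:
  assumes "1 \<le> i" "i \<le> n"
  shows "good_weight_last n i = i * tail_weight i i i * good_weight (n - i) +
    (\<Sum>r\<leftarrow>[1..<i]. r * pell r * upper_sum (n - r) (Suc i - r))"
proof -
  have "good_weight_last n i = (\<Sum>r\<in>insert i {1..<i}. r * tail_weight n i r)"
    using good_weight_last_eq[of n i] assms by (simp add: atLeastLessThanSuc_atLeastAtMost[symmetric] atLeastLessThanSuc)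
  also have "\<dots> = i * tail_weight n i i + (\<Sum>r\<in>{1..<i}. r * tail_weight n i r)" by simp
  also have "tail_weight n i i = tail_weight i i i * good_weight (n - i)" using tail_weight_diagonal[OF assms] by simp
  also have "(\<Sum>r\<in>{1..<i}. r * tail_weight n i r) = (\<Sum>r\<in>{1..<i}. r * pell r * upper_sum (n - r) (Suc i - r))"
  proof (rule sum.cong[OF refl])
    fix r assume r: "r \<in> {1..<i}"
    then have "tail_weight n i r = pell r * tail_weight (Suc (n - r)) (Suc (i - r)) 1"
      using tail_weight_off_diagonal[of r i n] assms by simp
    also have "tail_weight (Suc (n - r)) (Suc (i - r)) 1 = upper_sum (n - r) (Suc i - r)"
    proof -
      have "2 \<le> Suc (n - r)" "Suc (i - r) \<in> {1..Suc (n - r)}" "Suc (i - r) = Suc i - r"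
        using r assms by auto
      from tail_weight_one[OF this(1,2)] this(3) show ?thesis by (simp add: upper_sum_def)
    qed
    finally show "r * tail_weight n i r = r * pell r * upper_sum (n - r) (Suc i - r)" by simp
  qed
  also have "\<dots> = (\<Sum>r\<leftarrow>[1..<i]. r * pell r * upper_sum (n - r) (Suc i - r))"
    by (simp add: sum_list_distinct_conv_sum_set)
  finally show ?thesis by simp
qed

text \<open>Fills row \<open>n\<close> of the table from \<open>i = n\<close> downwards; apart from
  the entry just computed it needs only earlier rows. The sum is over a list so that it unfolds for
  concrete \<open>i\<close>.\<close>

lemma upper_sum_rec:
  assumes "1 \<le> i" "i \<le> n"
  shows "upper_sum n i = upper_sum n (Suc i) + i * tail_weight i i i * good_weight (n - i) +
    (\<Sum>r\<leftarrow>[1..<i]. r * pell r * upper_sum (n - r) (Suc i - r))"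
  using assms by (simp add: upper_sum_def sum.atLeast_Suc_atMost good_weight_last_rec)

section \<open>The table up to n = 10\<close>

lemma pell_values:
  "pell 2 = 2" "pell 3 = 5" "pell 4 = 12" "pell 5 = 29" "pell 6 = 70" "pell 7 = 169"
  "pell 8 = 408" "pell 9 = 985"
proof -
  have rec: "pell n = 2 * pell (n - 1) + pell (n - 2)" if "2 \<le> n" for n
    using that pell.simps(3)[of "n - 2"] by (simp add: numeral_2_eq_2 Suc_diff_Suc)
  show p2: "pell 2 = 2" and p3: "pell 3 = 5" using rec[of 3] rec[of 2] by simp_all
  show p4: "pell 4 = 12" and p5: "pell 5 = 29" using rec[of 5] rec[of 4] p2 p3 by simp_all
  show p6: "pell 6 = 70" and p7: "pell 7 = 169" using rec[of 7] rec[of 6] p4 p5 by simp_all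
  show p8: "pell 8 = 408" and p9: "pell 9 = 985" using rec[of 9] rec[of 8] p6 p7 by simp_all
qed

lemma tail_weight_diag_values:
  "tail_weight (Suc 0) (Suc 0) (Suc 0) = 1" "tail_weight 2 2 2 = 1" "tail_weight 3 3 3 = 3" "tail_weight 4 4 4 = 7" "tail_weight 5 5 5 = 17"
  "tail_weight 6 6 6 = 41" "tail_weight 7 7 7 = 99" "tail_weight 8 8 8 = 239" "tail_weight 9 9 9 = 577" "tail_weight 10 10 10 = 1393"
proof -
  have eq: "tail_weight n n n = pell (n - 1) + pell (n - 2)" if "2 \<le> n" for n
    using that tail_weight_diagonal_pell[of "n - 2"] by (simp add: numeral_2_eq_2 Suc_diff_Suc)
  show "tail_weight (Suc 0) (Suc 0) (Suc 0) = 1" using tail_weight_1 by simp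
  show "tail_weight 2 2 2 = 1" "tail_weight 3 3 3 = 3" "tail_weight 4 4 4 = 7" "tail_weight 5 5 5 = 17" "tail_weight 6 6 6 = 41"
    "tail_weight 7 7 7 = 99" "tail_weight 8 8 8 = 239" "tail_weight 9 9 9 = 577" "tail_weight 10 10 10 = 1393"
    by (simp_all add: eq pell_values)
qed

named_theorems upper_sum_values

lemmas upper_sum_eval =
  good_weight_eq_upper_sum upper_sum_gt good_weight_0 tail_weight_diag_values pell_values upt_rec numeral_2_eq_2[symmetric]

lemma upper_sum_1 [upper_sum_values]:
  "good_weight (Suc 0) = 1"
  "upper_sum (Suc 0) (Suc 0) = 1"
  by (simp_all add: upper_sum_eval upper_sum_values upper_sum_rec[where n = "Suc 0"])

lemma upper_sum_2 [upper_sum_values]: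
  "good_weight 2 = 3"
  "upper_sum 2 (Suc 0) = 3" "upper_sum 2 2 = 2"
  by (simp_all add: upper_sum_eval upper_sum_values upper_sum_rec[where n = 2])

lemma upper_sum_3 [upper_sum_values]:
  "good_weight 3 = 16"
  "upper_sum 3 (Suc 0) = 16" "upper_sum 3 2 = 13" "upper_sum 3 3 = 9"
  by (simp_all add: upper_sum_eval upper_sum_values upper_sum_rec[where n = 3])

lemma upper_sum_4 [upper_sum_values]:
  "good_weight 4 = 89"
  "upper_sum 4 (Suc 0) = 89" "upper_sum 4 2 = 73" "upper_sum 4 3 = 54" "upper_sum 4 4 = 28"
  by (simp_all add: upper_sum_eval upper_sum_values upper_sum_rec[where n = 4])

lemma upper_sum_5 [upper_sum_values]:
  "good_weight 5 = 534"
  "upper_sum 5 (Suc 0) = 534" "upper_sum 5 2 = 445" "upper_sum 5 3 = 340" "upper_sum 5 4 = 207"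
  "upper_sum 5 5 = 85"
  by (simp_all add: upper_sum_eval upper_sum_values upper_sum_rec[where n = 5])

lemma upper_sum_6 [upper_sum_values]:
  "good_weight 6 = 3394"
  "upper_sum 6 (Suc 0) = 3394" "upper_sum 6 2 = 2860" "upper_sum 6 3 = 2237"
  "upper_sum 6 4 = 1461" "upper_sum 6 5 = 759" "upper_sum 6 6 = 246"
  by (simp_all add: upper_sum_eval upper_sum_values upper_sum_rec[where n = 6])

lemma upper_sum_7 [upper_sum_values]:
  "good_weight 7 = 22447"
  "upper_sum 7 (Suc 0) = 22447" "upper_sum 7 2 = 19053" "upper_sum 7 3 = 15125"
  "upper_sum 7 4 = 10307" "upper_sum 7 5 = 5943" "upper_sum 7 6 = 2667" "upper_sum 7 7 = 693"
  by (simp_all add: upper_sum_eval upper_sum_values upper_sum_rec[where n = 7])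

lemma upper_sum_8 [upper_sum_values]:
  "good_weight 8 = 152901"
  "upper_sum 8 (Suc 0) = 152901" "upper_sum 8 2 = 130454" "upper_sum 8 3 = 104613"
  "upper_sum 8 4 = 73242" "upper_sum 8 5 = 44820" "upper_sum 8 6 = 23069" "upper_sum 8 7 = 9046"
  "upper_sum 8 8 = 1912"
  by (simp_all add: upper_sum_eval upper_sum_values upper_sum_rec[where n = 8])

lemma upper_sum_9 [upper_sum_values]:
  "good_weight 9 = 1065508"
  "upper_sum 9 (Suc 0) = 1065508" "upper_sum 9 2 = 912607" "upper_sum 9 3 = 737259"
  "upper_sum 9 4 = 525888" "upper_sum 9 5 = 334294" "upper_sum 9 6 = 185766"
  "upper_sum 9 7 = 86169" "upper_sum 9 8 = 29765" "upper_sum 9 9 = 5193"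
  by (simp_all add: upper_sum_eval upper_sum_values upper_sum_rec[where n = 9])

lemma upper_sum_10 [upper_sum_values]:
  "good_weight 10 = 7560824"
  "upper_sum 10 (Suc 0) = 7560824" "upper_sum 10 2 = 6495316" "upper_sum 10 3 = 5276907"
  "upper_sum 10 4 = 3815809" "upper_sum 10 5 = 2490642" "upper_sum 10 6 = 1453835"
  "upper_sum 10 7 = 740389" "upper_sum 10 8 = 311623" "upper_sum 10 9 = 95427"
  "upper_sum 10 10 = 13930"
  by (simp_all add: upper_sum_eval upper_sum_values upper_sum_rec[where n = 10])

section \<open>The recurrences\<close>

lemma tail_weight_small:
  "tail_weight 2 1 1 = 1" "tail_weight 2 2 1 = 0" "tail_weight 2 2 2 = 1"
  "tail_weight 3 1 1 = 3" "tail_weight 3 2 1 = 2" "tail_weight 3 2 2 = 1" "tail_weight 3 3 1 = 0" "tail_weight 3 3 2 = 0" "tail_weight 3 3 3 = 3"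
proof -
  have two: "upper_sum 1 1 = 1" "upper_sum 1 2 = 0" "upper_sum 2 1 = 3" "upper_sum 2 2 = 2"
    "upper_sum 2 3 = 0" "good_weight 1 = 1"
    using upper_sum_1 upper_sum_2 by (simp_all add: upper_sum_gt)
  have one: "tail_weight n i 1 = upper_sum (n - 1) i" if "2 \<le> n" "i \<in> {1..n}" for n i
    using tail_weight_one[OF that] by (simp add: upper_sum_def)
  show "tail_weight 2 1 1 = 1" "tail_weight 2 2 1 = 0" "tail_weight 3 1 1 = 3" "tail_weight 3 2 1 = 2" "tail_weight 3 3 1 = 0"
    using one[of 2 1] one[of 2 2] one[of 3 1] one[of 3 2] one[of 3 3] two by simp_all
  show "tail_weight 2 2 2 = 1" "tail_weight 3 3 3 = 3" by (simp_all add: tail_weight_diag_values)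
  show "tail_weight 3 2 2 = 1" using tail_weight_diagonal[of 2 3] two by (simp add: tail_weight_diag_values)
  show "tail_weight 3 3 2 = 0"
    using tail_weight_off_diagonal[of 2 3 3] one[of 2 2] two by (simp add: numeral_2_eq_2[symmetric])
qed

section \<open>From tail weights to counts of parking functions\<close>

lemma pk3_nat: "1 \<le> n \<Longrightarrow> pk3 n (int i) (int r) = r * tail_weight n i r"
  by (simp add: pk3_eq)

lemma pk3_nat_1: "1 \<le> n \<Longrightarrow> pk3 n (int i) 1 = tail_weight n i 1"
  using pk3_nat[of n i 1] by simp

lemma pk3_support:
  assumes "1 \<le> n" "pk3 n i r \<noteq> 0"
  shows "1 \<le> r \<and> r \<le> i \<and> i \<le> int n"
proof -
  have "0 \<le> i" "0 \<le> r" "tail_weight n (nat i) (nat r) \<noteq> 0"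
    using assms by (auto simp: pk3_eq split: if_splits)
  moreover from this(3) have "1 \<le> nat r \<and> nat r \<le> nat i \<and> nat i \<le> n"
    by (rule contrapos_np) (rule tail_weight_eq_0)
  ultimately show ?thesis by linarith
qed

lemma pk3_1: "pk3 1 i r = (if (i, r) = (1, 1) then 1 else 0)"
proof (cases "1 \<le> r \<and> r \<le> i \<and> i \<le> 1")
  case True
  then have "i = 1" "r = 1" by auto
  then show ?thesis using pk3_nat[of 1 1 1] tail_weight_1 by simp
next
  case False
  then show ?thesis using pk3_support[of 1 i r] by auto
qed

lemma pk3_2:
  "pk3 2 i r = (if (i, r) = (1, 1) then 1 else if (i, r) = (2, 2) then 2 else 0)"
proof (cases "1 \<le> r \<and> r \<le> i \<and> i \<le> 2")
  case True
  then consider "i = 1" "r = 1" | "i = 2" "r = 1" | "i = 2" "r = 2" by linarith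
  then show ?thesis
    using pk3_nat[of 2 1 1] pk3_nat[of 2 2 1] pk3_nat[of 2 2 2] tail_weight_small by cases simp_all
next
  case False
  then show ?thesis using pk3_support[of 2 i r] by auto
qed

lemma pk3_3:
  "pk3 3 i r =
    (if (i, r) = (1, 1) then 3
     else if (i, r) = (2, 1) \<or> (i, r) = (2, 2) then 2
     else if (i, r) = (3, 3) then 9
     else 0)"
proof (cases "1 \<le> r \<and> r \<le> i \<and> i \<le> 3")
  case True
  then consider "i = 1" "r = 1" | "i = 2" "r = 1" | "i = 2" "r = 2" | "i = 3" "r = 1" |
    "i = 3" "r = 2" | "i = 3" "r = 3" by linarith
  then show ?thesis
    using pk3_nat[of 3 1 1] pk3_nat[of 3 2 1] pk3_nat[of 3 2 2] pk3_nat[of 3 3 1]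
      pk3_nat[of 3 3 2] pk3_nat[of 3 3 3] tail_weight_small by cases simp_all
next
  case False
  then show ?thesis using pk3_support[of 3 i r] by auto
qed

text \<open>The theorem subtracts in the integers and \<open>tail_weight\<close> in the natural
  numbers; the bounds on \<open>k\<close> make the two agree.\<close>

lemma pk3_diff:
  assumes "k < n" "k \<le> i" "k \<le> r"
  shows "pk3 (n - k) (int i - int k) (int r - int k) = (r - k) * tail_weight (n - k) (i - k) (r - k)"
proof -
  have "int i - int k = int (i - k)" "int r - int k = int (r - k)" using assms by auto
  then show ?thesis using assms(1) by (simp only: pk3_nat zero_less_diff Suc_leI One_nat_def)
qed

text \<open>Passing from \<^const>\<open>tail_weight\<close> to \<^const>\<open>pk3\<close> multiplies by the run length of the last entry, which
  drops from \<open>r\<close> to \<open>r - k\<close> when a block of \<open>k\<close> entries is removed; hence the factors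
  \<open>r / (r - k)\<close>.\<close>

lemma pk3_rec:
  assumes "2 \<le> r" "r \<le> i" "i \<le> n"
  shows "real (pk3 n (int i) (int r)) =
    real r / (real r - 1) * real (pk3 (n - 1) (int i - 1) (int r - 1)) +
    (if r < i then real r * real (pk3 (n - r + 1) (int i - int r + 1) 1) else 0) +
    (\<Sum>k=2..r - 1. 2 * real r / (real r - real k) *
      real (pk3 (n - k) (int i - int k) (int r - int k)))"
proof -
  have step: "real r / (real r - real k) * real (pk3 (n - k) (int i - int k) (int r - int k)) =
      real r * real (tail_weight (n - k) (i - k) (r - k))" if "k < r" for k
    using pk3_diff[of k n i r] that assms by (simp add: of_nat_diff)
  have one: "real r / (real r - 1) * real (pk3 (n - 1) (int i - 1) (int r - 1)) =
      real r * real (tail_weight (n - 1) (i - 1) (r - 1))"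
    using step[of 1] assms(1) by simp
  have "int i - int r + 1 = int (i - r + 1)" using assms(2) by simp
  then have off: "pk3 (n - r + 1) (int i - int r + 1) 1 = tail_weight (n - r + 1) (i - r + 1) 1"
    by (simp only: pk3_nat_1 le_add2)
  have "2 * real r / (real r - real k) * real (pk3 (n - k) (int i - int k) (int r - int k)) =
      real r * (2 * real (tail_weight (n - k) (i - k) (r - k)))" if "k \<in> {2..r - 1}" for k
  proof -
    have "k < r" using that assms(1) by auto
    from arg_cong[OF step[OF this], of "\<lambda>x. 2 * x"] show ?thesis by simp
  qed
  then have sum: "(\<Sum>k=2..r - 1. 2 * real r / (real r - real k) *
      real (pk3 (n - k) (int i - int k) (int r - int k))) =
      real r * (\<Sum>k=2..r - 1. 2 * real (tail_weight (n - k) (i - k) (r - k)))"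
    unfolding sum_distrib_left by (rule sum.cong[OF refl])
  have "real (pk3 n (int i) (int r)) = real r * real (tail_weight n i r)"
    using pk3_nat[of n i r] assms by simp
  also have "\<dots> = real r * real (tail_weight (n - 1) (i - 1) (r - 1)) +
      (if r < i then real r * real (tail_weight (n - r + 1) (i - r + 1) 1) else 0) +
      real r * (\<Sum>k=2..r - 1. 2 * real (tail_weight (n - k) (i - k) (r - k)))"
    unfolding tail_weight_rec[OF assms] by (simp add: distrib_left)
  finally show ?thesis unfolding one off sum .
qed

lemma pk3_run_one:
  assumes "2 \<le> n" "i \<in> {1..n}"
  shows "pk3 n (int i) 1 = (\<Sum>j=i..n - 1. pk2 (n - 1) (int j))"
  using pk3_nat[of n i 1] tail_weight_one[OF assms] pk2_eq[of "n - 1"] assms by simp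

text \<open>For \<open>r = 2\<close> the sum is empty, and the removable block is either 1 alone or
  2 alone. Both lead to the same count, each with coefficient 2.\<close>

lemma pk3_run_two:
  assumes "3 \<le> i" "i \<le> n"
  shows "real (pk3 n (int i) 2) = 4 * real (pk3 (n - 1) (int i - 1) 1)"
  using pk3_rec[of 2 i n] assms by (simp add: Suc_diff_Suc numeral_2_eq_2)

text \<open>The factor \<open>r\<close> turns \<open>tail_weight r r r\<close> into
  \<open>pk2 r (int r)\<close>, by \<open>good_weight_last_diagonal\<close>.\<close>

lemma pk3_diagonal:
  assumes "1 \<le> r" "r \<le> n"
  shows "pk3 n (int r) (int r) = pk (n - r) * pk2 r (int r)"
  using assms pk3_nat[of n r r] tail_weight_diagonal[OF assms] good_weight_last_diagonal[of r]
  by (simp add: pk_eq pk2_eq)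

lemma pk_eq_sum_pk2: "1 \<le> n \<Longrightarrow> pk n = (\<Sum>i=1..n. pk2 n (int i))"
  by (simp add: pk_eq good_weight_eq pk2_eq)

lemma pk2_eq_sum_pk3: "1 \<le> n \<Longrightarrow> pk2 n (int i) = (\<Sum>r=1..i. pk3 n (int i) (int r))"
  by (simp add: pk2_eq good_weight_last_eq pk3_nat)

lemma pk_values:
  "map pk [1..<11] = [1, 3, 16, 89, 534, 3394, 22447, 152901, 1065508, 7560824]"
  by (simp add: upper_sum_values upt_rec pk_eq numeral_2_eq_2[symmetric])

theorem theorem4p4:
  shows
    "(\<forall>n\<ge>1. pk n = (\<Sum>i=1..n. pk2 n (int i))) \<and>
     (\<forall>n\<ge>1. \<forall>i\<in>{1..n}. pk2 n (int i) = (\<Sum>r=1..i. pk3 n (int i) (int r))) \<and>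
     (\<forall>i r. pk3 1 i r = (if (i, r) = (1, 1) then 1 else 0)) \<and>
     (\<forall>i r. pk3 2 i r =
        (if (i, r) = (1, 1) then 1 else if (i, r) = (2, 2) then 2 else 0)) \<and>
     (\<forall>i r. pk3 3 i r =
        (if (i, r) = (1, 1) then 3
         else if (i, r) = (2, 1) \<or> (i, r) = (2, 2) then 2
         else if (i, r) = (3, 3) then 9
         else 0)) \<and>
     (\<forall>n i r :: nat. 4 \<le> n \<and> 1 \<le> r \<and> r \<le> i \<and> i \<le> n \<longrightarrow>
        real (pk3 n (int i) (int r)) =
        (if r = 1 then
           (\<Sum>j=i..n-1. real (pk2 (n - 1) (int j)))
         else if r = 2 \<and> i = 2 then
           2 * real (pk (n - 2))
         else if r = 2 \<and> i \<noteq> 2 then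
           4 * real (pk3 (n - 1) (int i - 1) 1)
         else if i = r \<and> i < n then
           real (pk (n - r)) * real (pk2 r (int r))
         else if i = r \<and> i = n then
           real n / (real n - 1) * real (pk3 (n - 1) (int n - 1) (int n - 1)) +
           (\<Sum>r\<^sub>1=2..n-1. 2 * real n / (real n - real r\<^sub>1) *
              real (pk3 (n - r\<^sub>1) (int n - int r\<^sub>1) (int n - int r\<^sub>1)))
         else
           real r / (real r - 1) * real (pk3 (n - 1) (int i - 1) (int r - 1)) +
           real r * real (pk3 (n - r + 1) (int i - int r + 1) 1) +
           (\<Sum>r\<^sub>1=2..r-1. 2 * real r / (real r - real r\<^sub>1) *
              real (pk3 (n - r\<^sub>1) (int i - int r\<^sub>1) (int r - int r\<^sub>1))))) \<and>
     map pk [1..<11] =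
       [1, 3, 16, 89, 534, 3394, 22447, 152901, 1065508, 7560824]"
proof (intro conjI allI impI ballI)
  fix n i r :: nat
  assume "4 \<le> n \<and> 1 \<le> r \<and> r \<le> i \<and> i \<le> n"
  then have n: "4 \<le> n" "1 \<le> r" "r \<le> i" "i \<le> n" by auto
  consider (one) "r = 1" | (two) "r = 2" "i = 2" | (two') "r = 2" "i \<noteq> 2" |
    (diag) "r \<ge> 3" "i = r" "i < n" | (last) "r \<ge> 3" "i = r" "i = n" |
    (off) "r \<ge> 3" "r < i"
    using n by linarith
  then show "real (pk3 n (int i) (int r)) =
        (if r = 1 then
           (\<Sum>j=i..n-1. real (pk2 (n - 1) (int j)))
         else if r = 2 \<and> i = 2 then
           2 * real (pk (n - 2))
         else if r = 2 \<and> i \<noteq> 2 then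
           4 * real (pk3 (n - 1) (int i - 1) 1)
         else if i = r \<and> i < n then
           real (pk (n - r)) * real (pk2 r (int r))
         else if i = r \<and> i = n then
           real n / (real n - 1) * real (pk3 (n - 1) (int n - 1) (int n - 1)) +
           (\<Sum>r\<^sub>1=2..n-1. 2 * real n / (real n - real r\<^sub>1) *
              real (pk3 (n - r\<^sub>1) (int n - int r\<^sub>1) (int n - int r\<^sub>1)))
         else
           real r / (real r - 1) * real (pk3 (n - 1) (int i - 1) (int r - 1)) +
           real r * real (pk3 (n - r + 1) (int i - int r + 1) 1) +
           (\<Sum>r\<^sub>1=2..r-1. 2 * real r / (real r - real r\<^sub>1) *
              real (pk3 (n - r\<^sub>1) (int i - int r\<^sub>1) (int r - int r\<^sub>1))))"
  proof cases
    case one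
    then show ?thesis using pk3_run_one[of n i] n by simp
  next
    case two
    \<comment> \<open>The coefficient 2 of this case is pk(2,2), so the case is an instance of the
      diagonal formula.\<close>
    have "pk2 2 (int 2) = 2" using good_weight_last_diagonal[of 2] by (simp add: pk2_eq[of 2 2, simplified] tail_weight_diag_values)
    then show ?thesis using two pk3_diagonal[of 2 n] n by simp
  next
    case two'
    then show ?thesis using pk3_run_two[of i n] n by simp
  next
    case diag
    then show ?thesis using pk3_diagonal[of r n] n by simp
  next
    case last
    then show ?thesis using pk3_rec[of n n n] by simp
  next
    case off
    then show ?thesis using pk3_rec[of r i n] n by simp
  qed
qed (simp_all only: pk_eq_sum_pk2 pk2_eq_sum_pk3 pk3_1 pk3_2 pk3_3 pk_values)

end
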